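(* Let $\mathbb{K}$ be a field of characteristic zero, let $X,Y$ be non-commuting variables, and for $m\ge 2$ let $\Phi_m(X,Y)$ be the homogeneous component of degree $m$ of $\log(e^Xe^Y)$. Then for every $m\ge2$ $$\Phi_m(X,Y)=\sum_{\substack{i+j=m\\ i,j\ge1}}\frac{1}{i!}\,\frac{1}{j!}\,\frac1m\sum_{\sigma\in S_{m-1}}\frac{(-1)^{d_\sigma}}{\binom{m-1}{d_\sigma}}\,[X_{\sigma(1)},[X_{\sigma(2)},\cdots,[X_{\sigma(m-1)},Y]\cdots]],$$ where, in the term of the outer sum indexed by $(i,j)$, one sets $X_k=X$ for $1\le k\le i$ and $X_k=Y$ for $i+1\le k\le m-1$; $S_{m-1}$ is the group of permutations of $\{1,\dots,m-1\}$ and $d_\sigma$ is the number of descents of $\sigma$.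
   Context: Work in the associative algebra $\mathbb{K}\langle X,Y\rangle$ of formal power series over $\mathbb{K}$ in the non-commuting variables $X,Y$, with $[A,B]=AB-BA$. Here $e^{X}=\sum_{k\ge0}X^k/k!$ and $\log(1+Z)=\sum_{k\ge1}\frac{(-1)^{k-1}}{k}Z^k$ for $Z$ without constant term. For a permutation $\sigma$ of $\{1,\dots,k\}$, a descent is an index $l\in\{1,\dots,k-1\}$ with $\sigma(l)>\sigma(l+1)$, and $d_\sigma$ is the number of descents. *)

theory Defs
  imports Complex_Main "HOL-Combinatorics.Permutations"
begin

text \<open>
  Formal power series with coefficients in \<open>'a\<close> in non-commuting variables indexed by \<open>'v\<close>:
  a series is its family of coefficients, one for each word (list) over \<open>'v\<close>.
\<close>

typedef ('v, 'a) ncfps = "UNIV :: ('v list \<Rightarrow> 'a) set"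
  morphisms nc_coeff Abs_ncfps ..

lemma nc_coeff_Abs [simp]: "nc_coeff (Abs_ncfps f) = f"
  by (simp add: Abs_ncfps_inverse)

lemma ncfps_eqI: "(\<And>w. nc_coeff A w = nc_coeff B w) \<Longrightarrow> A = B"
  by (metis ext nc_coeff_inject)

definition splits :: "'v list \<Rightarrow> ('v list \<times> 'v list) set" where
  "splits w = {(u, v). u @ v = w}"

lemma splits_conv: "splits w = (\<lambda>i. (take i w, drop i w)) ` {..length w}"
proof -
  have "(u, v) \<in> (\<lambda>i. (take i w, drop i w)) ` {..length w}" if "u @ v = w" for u v
    using that by (intro image_eqI [where x = "length u"]) auto
  then show ?thesis
    by (auto simp: splits_def)
qed

lemma finite_splits [simp]: "finite (splits w)"
  by (simp add: splits_conv)

lemma splits_assoc: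
  fixes f g h :: "'v list \<Rightarrow> 'a::ring_1"
  shows "(\<Sum>(p, c)\<in>splits w. (\<Sum>(a, b)\<in>splits p. f a * g b) * h c)
       = (\<Sum>(a, q)\<in>splits w. f a * (\<Sum>(b, c)\<in>splits q. g b * h c))"
proof -
  have "(\<Sum>(p, c)\<in>splits w. (\<Sum>(a, b)\<in>splits p. f a * g b) * h c)
      = (\<Sum>x\<in>splits w. \<Sum>y\<in>splits (fst x). f (fst y) * g (snd y) * h (snd x))"
    by (simp add: sum_distrib_right split_beta)
  also have "\<dots> = (\<Sum>(x, y)\<in>Sigma (splits w) (\<lambda>x. splits (fst x)).
                    f (fst y) * g (snd y) * h (snd x))"
    by (rule sum.Sigma) auto
  also have "\<dots> = (\<Sum>(x, y)\<in>Sigma (splits w) (\<lambda>x. splits (snd x)).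
                    f (fst x) * (g (fst y) * h (snd y)))"
    by (rule sum.reindex_bij_witness
          [where i = "\<lambda>((a, q), (b, c)). ((a @ b, c), (a, b))"
             and j = "\<lambda>((p, c), (a, b)). ((a, b @ c), (b, c))"])
       (auto simp: splits_def mult.assoc)
  also have "\<dots> = (\<Sum>x\<in>splits w. \<Sum>y\<in>splits (snd x). f (fst x) * (g (fst y) * h (snd y)))"
    by (rule sum.Sigma [symmetric]) auto
  also have "\<dots> = (\<Sum>(a, q)\<in>splits w. f a * (\<Sum>(b, c)\<in>splits q. g b * h c))"
    by (simp add: sum_distrib_left split_beta)
  finally show ?thesis .
qed

instantiation ncfps :: (type, ring_1) ring_1
begin

definition "0 = Abs_ncfps (\<lambda>w. 0)"
definition "1 = Abs_ncfps (\<lambda>w. if w = [] then 1 else 0)"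
definition "A + B = Abs_ncfps (\<lambda>w. nc_coeff A w + nc_coeff B w)"
definition "- A = Abs_ncfps (\<lambda>w. - nc_coeff A w)"
definition "A - B = Abs_ncfps (\<lambda>w. nc_coeff A w - nc_coeff B w)"
definition "A * B = Abs_ncfps (\<lambda>w. \<Sum>(u, v)\<in>splits w. nc_coeff A u * nc_coeff B v)"

lemma nc_coeff_0 [simp]: "nc_coeff 0 w = 0"
  by (simp add: zero_ncfps_def)

lemma nc_coeff_1: "nc_coeff 1 w = (if w = [] then 1 else 0)"
  by (simp add: one_ncfps_def)

lemma nc_coeff_add [simp]: "nc_coeff (A + B) w = nc_coeff A w + nc_coeff B w"
  by (simp add: plus_ncfps_def)

lemma nc_coeff_uminus [simp]: "nc_coeff (- A) w = - nc_coeff A w"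
  by (simp add: uminus_ncfps_def)

lemma nc_coeff_diff [simp]: "nc_coeff (A - B) w = nc_coeff A w - nc_coeff B w"
  by (simp add: minus_ncfps_def)

lemma nc_coeff_mult:
  "nc_coeff (A * B) w = (\<Sum>(u, v)\<in>splits w. nc_coeff A u * nc_coeff B v)"
  by (simp add: times_ncfps_def)

instance
proof
  fix A B C :: "('a, 'b) ncfps"
  show "A + B + C = A + (B + C)" "A + B = B + A" "0 + A = A" "- A + A = 0" "A - B = A + - B"
    by (auto intro!: ncfps_eqI simp: add_ac)
  show "A * B * C = A * (B * C)"
    by (rule ncfps_eqI) (simp add: nc_coeff_mult splits_assoc)
  show "(A + B) * C = A * C + B * C" "A * (B + C) = A * B + A * C"
    by (auto intro!: ncfps_eqI simp: nc_coeff_mult split_beta algebra_simps sum.distrib)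
  show "1 * A = A"
  proof (rule ncfps_eqI)
    fix w
    have "nc_coeff (1 * A) w = (\<Sum>(u, v)\<in>{([], w)}. nc_coeff 1 u * nc_coeff A v)"
      unfolding nc_coeff_mult
      by (rule sum.mono_neutral_right, simp)
         (auto simp: splits_def nc_coeff_1 split: if_splits)
    then show "nc_coeff (1 * A) w = nc_coeff A w"
      by (simp add: nc_coeff_1)
  qed
  show "A * 1 = A"
  proof (rule ncfps_eqI)
    fix w
    have "nc_coeff (A * 1) w = (\<Sum>(u, v)\<in>{(w, [])}. nc_coeff A u * nc_coeff 1 v)"
      unfolding nc_coeff_mult
      by (rule sum.mono_neutral_right, simp)
         (auto simp: splits_def nc_coeff_1 split: if_splits)
    then show "nc_coeff (A * 1) w = nc_coeff A w"
      by (simp add: nc_coeff_1)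
  qed
  show "(0 :: ('a, 'b) ncfps) \<noteq> 1"
    by (metis nc_coeff_0 nc_coeff_1 zero_neq_one)
qed

end

definition nc_scale :: "'a::ring_1 \<Rightarrow> ('v, 'a) ncfps \<Rightarrow> ('v, 'a) ncfps" where
  "nc_scale c A = Abs_ncfps (\<lambda>w. c * nc_coeff A w)"

lemma nc_coeff_scale [simp]: "nc_coeff (nc_scale c A) w = c * nc_coeff A w"
  by (simp add: nc_scale_def)

definition nc_var :: "'v \<Rightarrow> ('v, 'a::ring_1) ncfps" where
  "nc_var x = Abs_ncfps (\<lambda>w. if w = [x] then 1 else 0)"

definition nc_bracket :: "('v, 'a::ring_1) ncfps \<Rightarrow> ('v, 'a) ncfps \<Rightarrow> ('v, 'a) ncfps" where
  "nc_bracket A B = A * B - B * A"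

definition nc_homog :: "nat \<Rightarrow> ('v, 'a::ring_1) ncfps \<Rightarrow> ('v, 'a) ncfps" where
  "nc_homog m A = Abs_ncfps (\<lambda>w. if length w = m then nc_coeff A w else 0)"

text \<open>
  The sum of a locally finite sequence of series, i.e. one in which every word has a nonzero
  coefficient in only finitely many terms; it is junk for other sequences. Local finiteness of
  the exponential and logarithmic series is \<open>nc_powers_locally_finite\<close> below.
\<close>

definition nc_sum :: "(nat \<Rightarrow> ('v, 'a::ring_1) ncfps) \<Rightarrow> ('v, 'a) ncfps" where
  "nc_sum F = Abs_ncfps (\<lambda>w. \<Sum>k | nc_coeff (F k) w \<noteq> 0. nc_coeff (F k) w)"

text \<open>Meant for \<open>Z\<close> without constant term.\<close>

definition nc_exp :: "('v, 'a::field_char_0) ncfps \<Rightarrow> ('v, 'a) ncfps" where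
  "nc_exp Z = nc_sum (\<lambda>k. nc_scale (1 / fact k) (Z ^ k))"

text \<open>Meant for \<open>A = 1 + Z\<close> with \<open>Z\<close> without constant term.\<close>

definition nc_log :: "('v, 'a::field_char_0) ncfps \<Rightarrow> ('v, 'a) ncfps" where
  "nc_log A = nc_sum (\<lambda>k. if k = 0 then 0 else nc_scale ((-1) ^ (k - 1) / of_nat k) ((A - 1) ^ k))"

lemma nc_coeff_power_eq_0:
  assumes "nc_coeff Z [] = 0" and "length w < k"
  shows "nc_coeff (Z ^ k) w = 0"
  using assms(2)
proof (induction k arbitrary: w)
  case (Suc k)
  have "nc_coeff Z u * nc_coeff (Z ^ k) v = 0" if "(u, v) \<in> splits w" for u v
  proof (cases "u = []")
    case False
    then have "length v < k"
      using that Suc.prems by (cases u) (auto simp: splits_def)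
    then show ?thesis by (simp add: Suc.IH)
  qed (simp add: assms(1))
  then show ?case
    by (auto simp: nc_coeff_mult intro!: sum.neutral)
qed simp

lemma nc_powers_locally_finite:
  assumes "nc_coeff Z [] = 0"
  shows "finite {k. nc_coeff (nc_scale (c k) (Z ^ k)) w \<noteq> 0}"
proof (rule finite_subset)
  show "{k. nc_coeff (nc_scale (c k) (Z ^ k)) w \<noteq> 0} \<subseteq> {..length w}"
    using nc_coeff_power_eq_0 [OF assms] by (force simp: not_less [symmetric])
qed simp

lemma nc_coeff_nc_sum:
  assumes "\<And>k. n < k \<Longrightarrow> nc_coeff (F k) w = 0"
  shows "nc_coeff (nc_sum F) w = (\<Sum>k\<le>n. nc_coeff (F k) w)"
  unfolding nc_sum_def nc_coeff_Abs
  by (rule sum.mono_neutral_left) (use assms in \<open>auto simp: not_less [symmetric]\<close>)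

lemma nc_coeff_exp:
  assumes "nc_coeff Z [] = 0"
  shows "nc_coeff (nc_exp Z) w = (\<Sum>k\<le>length w. nc_coeff (Z ^ k) w / fact k)"
  unfolding nc_exp_def
  by (subst nc_coeff_nc_sum [where n = "length w"]) (simp_all add: nc_coeff_power_eq_0 assms)

lemma nc_coeff_log:
  assumes "nc_coeff Z [] = 0"
  shows "nc_coeff (nc_log (1 + Z)) w
       = (\<Sum>k = 1..length w. (-1) ^ (k - 1) / of_nat k * nc_coeff (Z ^ k) w)"
proof -
  have *: "1 + Z - 1 = Z"
    by simp
  have "nc_coeff (nc_log (1 + Z)) w = (\<Sum>k\<le>length w. nc_coeff
      (if k = 0 then 0 else nc_scale ((-1) ^ (k - 1) / of_nat k) (Z ^ k)) w)"
    unfolding nc_log_def *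
    by (subst nc_coeff_nc_sum [where n = "length w"]) (simp_all add: nc_coeff_power_eq_0 assms)
  also have "\<dots> = (\<Sum>k = 1..length w. nc_coeff
      (if k = 0 then 0 else nc_scale ((-1) ^ (k - 1) / of_nat k) (Z ^ k)) w)"
    by (rule sum.mono_neutral_right) auto
  finally show ?thesis
    by simp
qed

datatype letter = LX | LY

definition varX :: "(letter, 'a::ring_1) ncfps" where
  "varX = nc_var LX"

definition varY :: "(letter, 'a::ring_1) ncfps" where
  "varY = nc_var LY"

lemma nc_coeff_exp_mult_Nil:
  "nc_coeff (nc_exp varX * nc_exp varY - (1 :: (letter, 'a::field_char_0) ncfps)) [] = 0"
  by (simp add: nc_coeff_mult splits_def nc_coeff_exp varX_def varY_def nc_var_def nc_coeff_1)

definition bch_component :: "nat \<Rightarrow> (letter, 'a::field_char_0) ncfps" where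
  "bch_component m = nc_homog m (nc_log (nc_exp varX * nc_exp varY))"

text \<open>The number of descents of a permutation of \<open>{1..k}\<close>.\<close>

definition descents :: "nat \<Rightarrow> (nat \<Rightarrow> nat) \<Rightarrow> nat" where
  "descents k \<sigma> = card {l. 1 \<le> l \<and> l < k \<and> \<sigma> l > \<sigma> (l + 1)}"

text \<open>\<open>nested_bracket [A\<^sub>1, \<dots>, A\<^sub>n] B = [A\<^sub>1, [A\<^sub>2, \<dots>, [A\<^sub>n, B] \<dots>]]\<close>\<close>

definition nested_bracket ::
    "('v, 'a::ring_1) ncfps list \<Rightarrow> ('v, 'a) ncfps \<Rightarrow> ('v, 'a) ncfps" where
  "nested_bracket As B = foldr nc_bracket As B"

end

theory Submission
  imports Defs "HOL-Computational_Algebra.Polynomial"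
begin

text \<open>
  Put \<open>G = e\<^sup>X e\<^sup>Y\<close> and let \<open>D\<close> be the derivation with \<open>D X = 0\<close> and \<open>D Y = Y\<close>, so that
  \<open>D G = G Y\<close> and \<open>D (G\<^sup>n) = (\<Sum>l=1..n. G\<^sup>l Y G\<^bsup>-l\<^esup>) G\<^sup>n\<close>. Letting each letter of a word act by its
  bracket is an algebra homomorphism that takes \<open>G\<close> to conjugation by \<open>G\<close>. Hence \<open>G\<^sup>l Y G\<^bsup>-l\<^esup>\<close> is the
  sum over all words \<open>w\<close> of the nested bracket \<open>[w, Y]\<close> times the coefficient of \<open>w\<close> in \<open>G\<^sup>l\<close>. All
  coefficients are polynomials in \<open>n\<close>; comparing the terms linear in \<open>n\<close>, which for \<open>G\<^sup>n\<close> is \<open>log G\<close>,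
  gives \<open>D (log G) = \<Sum>w. c\<^sub>w [w, Y]\<close> with \<open>c\<^sub>w\<close> the linear term of the sum over \<open>l = 1..n\<close> of the
  coefficient of \<open>w\<close> in \<open>G\<^sup>l\<close>.

  Cutting permutations into \<open>n\<close> increasing runs shows that, for \<open>w\<close> of length \<open>N\<close> with \<open>i\<close> letters \<open>X\<close>
  and \<open>j'\<close> letters \<open>Y\<close>, the coefficient of \<open>w\<close> in \<open>G\<^sup>n\<close> is \<open>1 / (i! j'!)\<close> times the sum, over the
  permutations \<open>\<sigma>\<close> of type \<open>w\<close>, of \<open>(n + N - 1 - d\<^sub>\<sigma>) choose N\<close>, whence \<open>c\<^sub>w\<close>.
\<close>

section \<open>Words acting by brackets\<close>

lemma finite_letter [simp]: "finite (UNIV :: letter set)"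
proof -
  have "(UNIV :: letter set) = {LX, LY}"
    using letter.exhaust by auto
  then show ?thesis by (metis finite.emptyI finite.insertI)
qed

lemma finite_words [simp]: "finite {w :: letter list. length w \<le> n}"
  using finite_lists_length_le [OF finite_letter, of n] by simp

lemma sum_splits_Cons:
  "(\<Sum>(u, v)\<in>splits (a # w). f u v) = f [] (a # w) + (\<Sum>(u, v)\<in>splits w. f (a # u) v)"
proof -
  have eq: "splits (a # w) = insert ([], a # w) ((\<lambda>(u, v). (a # u, v)) ` splits w)"
    by (auto simp: splits_def image_iff Cons_eq_append_conv append_eq_Cons_conv)
  have "inj_on (\<lambda>(u, v). (a # u, v)) (splits w)"
    by (auto simp: inj_on_def)
  then show ?thesis
    unfolding eq
    by (subst sum.insert) (auto simp: sum.reindex split_def)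
qed

lemma splits_Nil [simp]: "splits [] = {([], [])}"
  by (auto simp: splits_def)

lemma nc_coeff_sum [simp]: "nc_coeff (sum f A) w = (\<Sum>a\<in>A. nc_coeff (f a) w)"
  by (induction A rule: infinite_finite_induct) auto

lemma nc_coeff_var: "nc_coeff (nc_var x) w = (if w = [x] then 1 else 0)"
  by (simp add: nc_var_def)

lemma nc_scale_mult_left: "nc_scale c A * B = nc_scale c (A * B)"
  by (rule ncfps_eqI) (simp add: nc_coeff_mult sum_distrib_left split_beta mult.assoc)

lemma nc_scale_mult_right:
  fixes c :: "'a::comm_ring_1"
  shows "A * nc_scale c B = nc_scale c (A * B)"
  by (rule ncfps_eqI) (simp add: nc_coeff_mult sum_distrib_left split_beta mult.left_commute)

lemma nc_scale_sum: "nc_scale c (sum f A) = (\<Sum>a\<in>A. nc_scale c (f a))"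
  by (rule ncfps_eqI) (simp add: sum_distrib_left)

lemma nc_scale_scale: "nc_scale c (nc_scale d A) = nc_scale (c * d) A"
  by (rule ncfps_eqI) (simp add: mult.assoc)

lemma nc_coeff_var_mult_Cons:
  "nc_coeff (nc_var x * A) (y # v) = (if y = x then nc_coeff A v else 0)"
proof -
  have "nc_coeff (nc_var x * A) (y # v) =
      (\<Sum>(a, b)\<in>splits v. (if y # a = [x] then nc_coeff A b else 0))"
    by (auto simp: nc_coeff_mult sum_splits_Cons nc_coeff_var intro!: sum.cong)
  also have "\<dots> = (\<Sum>(a, b)\<in>{([], v)}. (if y # a = [x] then nc_coeff A b else 0))"
    by (rule sum.mono_neutral_right [OF finite_splits]) (auto simp: splits_def split: if_splits)
  finally show ?thesis by simp
qed

lemma nc_coeff_var_mult_Nil: "nc_coeff (nc_var x * A) [] = 0"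
  by (simp add: nc_coeff_mult nc_coeff_var)

lemma nc_coeff_mult_var_snoc:
  "nc_coeff (A * nc_var x) (v @ [y]) = (if y = x then nc_coeff A v else 0)"
proof -
  have "nc_coeff (A * nc_var x) (v @ [y]) =
      (\<Sum>(a, b)\<in>{(v, [y])}. nc_coeff A a * (if b = [x] then 1 else 0))"
    unfolding nc_coeff_mult nc_coeff_var
    by (rule sum.mono_neutral_right [OF finite_splits]) (auto simp: splits_def split: if_splits)
  then show ?thesis by simp
qed

lemma nc_coeff_mult_var_Nil: "nc_coeff (A * nc_var x) [] = 0"
  by (simp add: nc_coeff_mult nc_coeff_var)

section \<open>Order of vanishing and agreement up to a given degree\<close>

definition vanish :: "nat \<Rightarrow> ('v, 'a::ring_1) ncfps \<Rightarrow> bool" where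
  "vanish n A \<longleftrightarrow> (\<forall>w. length w < n \<longrightarrow> nc_coeff A w = 0)"

lemma vanish_mult:
  assumes "vanish p A" "vanish q B"
  shows "vanish (p + q) (A * B)"
  unfolding vanish_def
proof (intro allI impI)
  fix w :: "'a list"
  assume w: "length w < p + q"
  have "nc_coeff A u * nc_coeff B v = 0" if "(u, v) \<in> splits w" for u v
  proof (cases "length u < p")
    case True
    then show ?thesis using assms by (simp add: vanish_def)
  next
    case False
    then have "length v < q"
      using that w by (auto simp: splits_def)
    then show ?thesis using assms by (simp add: vanish_def)
  qed
  then show "nc_coeff (A * B) w = 0"
    unfolding nc_coeff_mult by (intro sum.neutral) auto
qed

lemma vanish_diff: "vanish n A \<Longrightarrow> vanish n B \<Longrightarrow> vanish n (A - B)"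
  by (simp add: vanish_def)

lemma vanish_0 [simp]: "vanish 0 A"
  by (simp add: vanish_def)

lemma vanish_var: "vanish 1 (nc_var x)"
  by (auto simp: vanish_def nc_coeff_var)

lemma vanish_power: "vanish 1 A \<Longrightarrow> vanish k (A ^ k)"
  by (induction k) (use vanish_mult [of 1 A] in auto)

lemma vanish_bracket_var:
  assumes "vanish n A"
  shows "vanish (Suc n) (nc_bracket (nc_var x) A)"
  unfolding nc_bracket_def
  using vanish_mult [OF vanish_var [of x] assms] vanish_mult [OF assms vanish_var [of x]]
  by (auto intro: vanish_diff)

text \<open>Congruence modulo words longer than \<open>n\<close>. Modulo these,
  \<open>nc_exp\<close> and \<open>act\<close> become finite sums, so identities of series reduce to
  finite algebra for each \<open>n\<close>.\<close>

definition eq_upto :: "nat \<Rightarrow> ('v, 'a::ring_1) ncfps \<Rightarrow> ('v, 'a) ncfps \<Rightarrow> bool" where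
  "eq_upto n A B \<longleftrightarrow> (\<forall>w. length w \<le> n \<longrightarrow> nc_coeff A w = nc_coeff B w)"

lemma eq_upto_refl [simp]: "eq_upto n A A"
  by (simp add: eq_upto_def)

lemma eq_upto_trans [trans]: "eq_upto n A B \<Longrightarrow> eq_upto n B C \<Longrightarrow> eq_upto n A C"
  by (simp add: eq_upto_def)

lemma eq_upto_sym: "eq_upto n A B \<Longrightarrow> eq_upto n B A"
  by (simp add: eq_upto_def)

lemma eq_uptoI_all: "(\<And>n. eq_upto n A B) \<Longrightarrow> A = B"
  by (rule ncfps_eqI) (auto simp: eq_upto_def)

lemma eq_upto_diff: "eq_upto n A A' \<Longrightarrow> eq_upto n B B' \<Longrightarrow> eq_upto n (A - B) (A' - B')"
  by (simp add: eq_upto_def)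

lemma eq_upto_mult:
  assumes "eq_upto n A A'" "eq_upto n B B'"
  shows "eq_upto n (A * B) (A' * B')"
  unfolding eq_upto_def
proof (intro allI impI)
  fix w :: "'a list"
  assume w: "length w \<le> n"
  have "nc_coeff A u = nc_coeff A' u \<and> nc_coeff B v = nc_coeff B' v" if "(u, v) \<in> splits w" for u v
    using that w assms by (auto simp: splits_def eq_upto_def)
  then show "nc_coeff (A * B) w = nc_coeff (A' * B') w"
    unfolding nc_coeff_mult by (intro sum.cong) auto
qed

lemma eq_upto_exp:
  fixes Z :: "('v, 'a::field_char_0) ncfps"
  assumes "nc_coeff Z [] = 0"
  shows "eq_upto n (nc_exp Z) (\<Sum>k\<le>n. nc_scale (1 / fact k) (Z ^ k))"
  unfolding eq_upto_def
proof (intro allI impI)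
  fix w :: "'v list"
  assume w: "length w \<le> n"
  have "nc_coeff (nc_exp Z) w = (\<Sum>k\<le>length w. nc_coeff (Z ^ k) w / fact k)"
    by (rule nc_coeff_exp) fact
  also have "\<dots> = (\<Sum>k\<le>n. nc_coeff (Z ^ k) w / fact k)"
    by (rule sum.mono_neutral_left) (use w in \<open>auto simp: nc_coeff_power_eq_0 [OF assms]\<close>)
  finally show "nc_coeff (nc_exp Z) w = nc_coeff (\<Sum>k\<le>n. nc_scale (1 / fact k) (Z ^ k)) w"
    by simp
qed

section \<open>Series acting by nested brackets\<close>

definition ad_word :: "'v list \<Rightarrow> ('v, 'a::ring_1) ncfps \<Rightarrow> ('v, 'a) ncfps" where
  "ad_word w B = nested_bracket (map nc_var w) B"

lemma ad_word_Nil [simp]: "ad_word [] B = B"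
  by (simp add: ad_word_def nested_bracket_def)

lemma ad_word_Cons [simp]: "ad_word (x # w) B = nc_bracket (nc_var x) (ad_word w B)"
  by (simp add: ad_word_def nested_bracket_def)

lemma vanish_ad_word: "vanish (length w) (ad_word w B)"
  by (induction w) (auto intro: vanish_bracket_var)

text \<open>This is \<open>A\<close> with every variable \<open>x\<close> replaced by the operator
  \<open>nc_bracket (nc_var x)\<close>, applied to \<open>B\<close>. Stopping at
  \<open>length z\<close> loses nothing: by \<open>vanish_ad_word\<close> a longer \<open>w\<close>
  contributes zero at \<open>z\<close>.\<close>

definition act :: "(letter, 'a::ring_1) ncfps \<Rightarrow> (letter, 'a) ncfps \<Rightarrow> (letter, 'a) ncfps" where
  "act A B = Abs_ncfps (\<lambda>z. \<Sum>w | length w \<le> length z. nc_coeff A w * nc_coeff (ad_word w B) z)"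

lemma eq_upto_act:
  "eq_upto n (act A B) (\<Sum>w | length w \<le> n. nc_scale (nc_coeff A w) (ad_word w B))"
  unfolding eq_upto_def
proof (intro allI impI)
  fix z :: "letter list"
  assume z: "length z \<le> n"
  have "(\<Sum>w | length w \<le> length z. nc_coeff A w * nc_coeff (ad_word w B) z) =
    (\<Sum>w | length w \<le> n. nc_coeff A w * nc_coeff (ad_word w B) z)"
  proof (rule sum.mono_neutral_left)
    show "\<forall>w\<in>{w. length w \<le> n} - {w. length w \<le> length z}.
            nc_coeff A w * nc_coeff (ad_word w B) z = 0"
    proof
      fix w :: "letter list"
      assume "w \<in> {w. length w \<le> n} - {w. length w \<le> length z}"
      then show "nc_coeff A w * nc_coeff (ad_word w B) z = 0"
        using vanish_ad_word [of w B] by (simp add: vanish_def)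
    qed
  qed (use z in auto)
  then show "nc_coeff (act A B) z =
      nc_coeff (\<Sum>w | length w \<le> n. nc_scale (nc_coeff A w) (ad_word w B)) z"
    by (simp add: act_def)
qed

lemma nc_coeff_act:
  "length z \<le> n \<Longrightarrow>
    nc_coeff (act A B) z = (\<Sum>w | length w \<le> n. nc_coeff A w * nc_coeff (ad_word w B) z)"
  using eq_upto_act [of n A B] by (simp add: eq_upto_def)

lemma act_cong: "eq_upto n A A' \<Longrightarrow> eq_upto n (act A B) (act A' B)"
  by (auto simp: eq_upto_def act_def)

lemma act_sum: "act (sum f I) B = (\<Sum>i\<in>I. act (f i) B)"
  by (rule ncfps_eqI) (simp add: act_def sum_distrib_right sum.swap [of _ I])

lemma act_scale: "act (nc_scale c A) B = nc_scale c (act A B)"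
  by (rule ncfps_eqI) (simp add: act_def sum_distrib_left mult.assoc)

lemma act_1: "act 1 B = B"
proof (rule ncfps_eqI)
  fix z
  have "nc_coeff (act 1 B) z = (\<Sum>w\<in>{[]}. nc_coeff 1 w * nc_coeff (ad_word w B) z)"
    unfolding act_def nc_coeff_Abs
    by (rule sum.mono_neutral_right) (auto simp: nc_coeff_1)
  then show "nc_coeff (act 1 B) z = nc_coeff B z"
    by (simp add: nc_coeff_1)
qed

lemma nc_bracket_sum_right: "nc_bracket A (sum f I) = (\<Sum>i\<in>I. nc_bracket A (f i))"
  by (simp add: nc_bracket_def sum_distrib_left sum_distrib_right sum_subtractf)

lemma nc_bracket_scale_right:
  fixes c :: "'a::comm_ring_1"
  shows "nc_bracket A (nc_scale c B) = nc_scale c (nc_bracket A B)"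
  by (rule ncfps_eqI)
    (simp add: nc_bracket_def nc_scale_mult_left nc_scale_mult_right right_diff_distrib)

text \<open>Multiplicativity of \<open>act\<close> for a single letter on the left: only words
  starting with \<open>x\<close> survive, and \<open>ad_word\<close> turns that first letter into an
  outer bracket. Powers of a variable and exponentials follow from this case.\<close>

lemma act_var_mult:
  fixes A B :: "(letter, 'a::comm_ring_1) ncfps"
  shows "act (nc_var x * A) B = nc_bracket (nc_var x) (act A B)"
proof (rule ncfps_eqI)
  fix z :: "letter list"
  define n where "n = length z"
  have img: "{w. length w \<le> Suc n} = insert [] ((\<lambda>(y, w). y # w) ` (UNIV \<times> {w :: letter list. length w \<le> n}))"
  proof -
    have "w = [] \<or> (\<exists>y v. w = y # v \<and> length v \<le> n)" if "length w \<le> Suc n" for w :: "letter list"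
      using that by (cases w) auto
    then show ?thesis by (auto simp: image_iff)
  qed
  \<comment> \<open>Expanding up to \<open>Suc n\<close> rather than \<open>n\<close> leaves exactly
    the words of length at most \<open>n\<close> once the leading \<open>x\<close> is
    stripped.\<close>
  have "nc_coeff (act (nc_var x * A) B) z =
      (\<Sum>w | length w \<le> Suc n. nc_coeff (nc_var x * A) w * nc_coeff (ad_word w B) z)"
    by (rule nc_coeff_act) (simp add: n_def)
  also have "\<dots> = (\<Sum>w\<in>(\<lambda>w. x # w) ` {w. length w \<le> n}.
      nc_coeff (nc_var x * A) w * nc_coeff (ad_word w B) z)"
    by (rule sum.mono_neutral_right)
      (auto simp: img nc_coeff_var_mult_Nil nc_coeff_var_mult_Cons)
  also have "\<dots> = (\<Sum>w | length w \<le> n. nc_coeff A w * nc_coeff (ad_word (x # w) B) z)"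
    by (subst sum.reindex) (auto simp: nc_coeff_var_mult_Cons)
  also have "\<dots> = nc_coeff (nc_bracket (nc_var x)
      (\<Sum>w | length w \<le> n. nc_scale (nc_coeff A w) (ad_word w B))) z"
    by (simp add: nc_bracket_sum_right nc_bracket_scale_right)
  also have "\<dots> = nc_coeff (nc_bracket (nc_var x) (act A B)) z"
  proof -
    have "eq_upto n (nc_bracket (nc_var x) (act A B)) (nc_bracket (nc_var x)
      (\<Sum>w | length w \<le> n. nc_scale (nc_coeff A w) (ad_word w B)))"
      unfolding nc_bracket_def by (intro eq_upto_diff eq_upto_mult eq_upto_act eq_upto_refl)
    then show ?thesis by (simp add: eq_upto_def n_def)
  qed
  finally show "nc_coeff (act (nc_var x * A) B) z = nc_coeff (nc_bracket (nc_var x) (act A B)) z" .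
qed

lemma act_var_power_mult:
  fixes A B :: "(letter, 'a::comm_ring_1) ncfps"
  shows "act (nc_var x ^ k * A) B = (nc_bracket (nc_var x) ^^ k) (act A B)"
  by (induction k) (simp_all add: act_var_mult mult.assoc)

text \<open>The binomial theorem for the commuting operators \<open>[X, _]\<close> and right multiplication by
  \<open>X\<close>, whose sum is left multiplication by \<open>X\<close>.\<close>

lemma power_mult_eq_sum_bracket:
  fixes X B :: "('v, 'a::field_char_0) ncfps"
  shows "(\<Sum>k\<le>n. nc_scale (1 / (fact k * fact (n - k))) ((nc_bracket X ^^ k) B * X ^ (n - k)))
    = nc_scale (1 / fact n) (X ^ n * B)"
proof -
  have "X ^ n * B = (\<Sum>k\<le>n. of_nat (n choose k) * ((nc_bracket X ^^ k) B * X ^ (n - k)))"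
  proof (induction n)
    case (Suc n)
    let ?t = "\<lambda>k l. (nc_bracket X ^^ k) B * X ^ l"
    have X: "X * ?t k l = ?t (Suc k) l + ?t k (Suc l)" for k l
      by (simp add: nc_bracket_def algebra_simps)
    have of_nat_X: "X * (of_nat c * A) = of_nat c * (X * A)" for c A
      by (metis mult.assoc mult_of_nat_commute)
    have "X ^ Suc n * B = X * (\<Sum>k\<le>n. of_nat (n choose k) * ?t k (n - k))"
      by (simp add: Suc mult.assoc)
    also have "\<dots> = (\<Sum>k\<le>n. of_nat (n choose k) * (?t (Suc k) (n - k) + ?t k (Suc (n - k))))"
      unfolding sum_distrib_left of_nat_X X ..
    also have "\<dots> = (\<Sum>k\<le>n. of_nat (n choose k) * ?t (Suc k) (n - k))
        + (\<Sum>k\<le>n. of_nat (n choose k) * ?t k (Suc n - k))"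
      unfolding distrib_left sum.distrib
      by (intro arg_cong2 [where f = "(+)"] sum.cong) (simp_all add: Suc_diff_le)
    also have "(\<Sum>k\<le>n. of_nat (n choose k) * ?t (Suc k) (n - k))
        = (\<Sum>k\<le>Suc n. (if k = 0 then 0 else of_nat (n choose (k - 1)) * ?t k (Suc n - k)))"
      by (subst sum.atMost_Suc_shift) simp
    also have "(\<Sum>k\<le>n. of_nat (n choose k) * ?t k (Suc n - k))
        = (\<Sum>k\<le>Suc n. of_nat (n choose k) * ?t k (Suc n - k))"
      by (simp add: binomial_eq_0)
    also have "(\<Sum>k\<le>Suc n. (if k = 0 then 0 else of_nat (n choose (k - 1)) * ?t k (Suc n - k)))
        + (\<Sum>k\<le>Suc n. of_nat (n choose k) * ?t k (Suc n - k))
        = (\<Sum>k\<le>Suc n. of_nat (Suc n choose k) * ?t k (Suc n - k))"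
      unfolding sum.distrib [symmetric]
    proof (rule sum.cong)
      fix k
      show "(if k = 0 then 0 else of_nat (n choose (k - 1)) * ?t k (Suc n - k))
          + of_nat (n choose k) * ?t k (Suc n - k) = of_nat (Suc n choose k) * ?t k (Suc n - k)"
        by (cases k) (simp_all add: distrib_right)
    qed simp
    finally show ?case .
  qed simp
  moreover have "of_nat c * A = nc_scale (of_nat c) A" for c :: nat and A :: "('v, 'a) ncfps"
    by (induction c) (auto intro!: ncfps_eqI simp: algebra_simps)
  ultimately have "nc_scale (1 / fact n) (X ^ n * B) =
    (\<Sum>k\<le>n. nc_scale (1 / fact n * of_nat (n choose k)) ((nc_bracket X ^^ k) B * X ^ (n - k)))"
    by (simp add: nc_scale_sum nc_scale_scale)
  also have "\<dots> = (\<Sum>k\<le>n. nc_scale (1 / (fact k * fact (n - k))) ((nc_bracket X ^^ k) B * X ^ (n - k)))"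
    by (intro sum.cong refl) (simp add: binomial_fact)
  finally show ?thesis by simp
qed

lemma vanish_funpow_bracket_var: "vanish k ((nc_bracket (nc_var x) ^^ k) B)"
  by (induction k) (auto intro: vanish_bracket_var)

text \<open>The identity \<open>e^(ad X) C = e^X C e^(-X)\<close> with \<open>C = act A B\<close>,
  multiplied by \<open>e^X\<close> on the right so that no inverse occurs. After truncation the left
  side is a double sum of bracket powers times right powers, and its diagonals are binomial
  expansions.\<close>

lemma act_exp_mult:
  fixes A B :: "(letter, 'a::field_char_0) ncfps"
  shows "act (nc_exp (nc_var x) * A) B * nc_exp (nc_var x) = nc_exp (nc_var x) * act A B"
proof (rule eq_uptoI_all)
  fix n
  let ?X = "nc_var x :: (letter, 'a) ncfps" and ?C = "act A B"
  let ?e = "\<Sum>k\<le>n. nc_scale (1 / fact k) (?X ^ k)"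
  let ?t = "\<lambda>k l. nc_scale (1 / (fact k * fact l)) ((nc_bracket ?X ^^ k) ?C * ?X ^ l)"
  have e: "eq_upto n (nc_exp ?X) ?e"
    by (rule eq_upto_exp) (simp add: nc_coeff_var)
  have "eq_upto n (act (nc_exp ?X * A) B * nc_exp ?X) (act (?e * A) B * ?e)"
    by (intro eq_upto_mult act_cong e eq_upto_refl)
  also have "act (?e * A) B * ?e = (\<Sum>k\<le>n. \<Sum>l\<le>n. ?t k l)"
    by (simp add: sum_distrib_left sum_distrib_right nc_scale_mult_left nc_scale_mult_right act_sum
        act_scale act_var_power_mult nc_scale_scale nc_scale_sum mult.commute)
       (subst sum.swap, simp add: mult.commute)
  \<comment> \<open>The term \<open>?t k l\<close> vanishes on words shorter than
    \<open>k + l\<close>, so modulo longer words the square may be cut down to the triangle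
    \<open>k + l <= n\<close> and summed along the diagonals \<open>k + l = s\<close>.\<close>
  also have "eq_upto n (\<Sum>k\<le>n. \<Sum>l\<le>n. ?t k l) (\<Sum>s\<le>n. \<Sum>k\<le>s. ?t k (s - k))"
    unfolding eq_upto_def
  proof (intro allI impI)
    fix w :: "letter list"
    assume w: "length w \<le> n"
    have 0: "nc_coeff (?t k l) w = 0" if "n < k + l" for k l
    proof -
      have "vanish (k + l) ((nc_bracket ?X ^^ k) ?C * ?X ^ l)"
        by (intro vanish_mult vanish_funpow_bracket_var vanish_power vanish_var)
      then show ?thesis using that w by (simp add: vanish_def)
    qed
    have "(\<Sum>k\<le>n. \<Sum>l\<le>n. nc_coeff (?t k l) w) = (\<Sum>(k, l)\<in>{..n} \<times> {..n}. nc_coeff (?t k l) w)"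
      by (simp add: sum.cartesian_product)
    also have "\<dots> = (\<Sum>(k, l)\<in>{(k, l). k + l \<le> n}. nc_coeff (?t k l) w)"
    proof (rule sum.mono_neutral_right)
      show "\<forall>p\<in>{..n} \<times> {..n} - {(k, l). k + l \<le> n}. (case p of (k, l) \<Rightarrow> nc_coeff (?t k l) w) = 0"
        using 0 by (auto simp only: not_le [symmetric] prod.case mem_Collect_eq split_paired_all Diff_iff)
    qed auto
    also have "\<dots> = (\<Sum>s\<le>n. \<Sum>k\<le>s. nc_coeff (?t k (s - k)) w)"
      by (rule sum.triangle_reindex_eq)
    finally show "nc_coeff (\<Sum>k\<le>n. \<Sum>l\<le>n. ?t k l) w = nc_coeff (\<Sum>s\<le>n. \<Sum>k\<le>s. ?t k (s - k)) w"
      by simp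
  qed
  also have "(\<Sum>s\<le>n. \<Sum>k\<le>s. ?t k (s - k)) = ?e * ?C"
    by (simp add: power_mult_eq_sum_bracket sum_distrib_right nc_scale_mult_left)
  also have "eq_upto n (?e * ?C) (nc_exp ?X * ?C)"
    by (intro eq_upto_mult eq_upto_sym [OF e] eq_upto_refl)
  finally show "eq_upto n (act (nc_exp ?X * A) B * nc_exp ?X) (nc_exp ?X * ?C)" .
qed

lemma nc_coeff_var_power: "nc_coeff (nc_var x ^ k) w = (if w = replicate k x then 1 else 0)"
proof (induction k arbitrary: w)
  case 0
  then show ?case by (simp add: nc_coeff_1)
next
  case (Suc k)
  then show ?case
    by (cases w) (auto simp: nc_coeff_var_mult_Nil nc_coeff_var_mult_Cons)
qed

lemma nc_coeff_exp_var:
  "nc_coeff (nc_exp (nc_var x)) w = (if w = replicate (length w) x then 1 / fact (length w) else 0)"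
proof -
  have "nc_coeff (nc_exp (nc_var x)) w
      = (\<Sum>k\<le>length w. (if w = replicate k x then 1 else 0) / fact k)"
    by (subst nc_coeff_exp) (simp_all add: nc_coeff_var nc_coeff_var_power)
  also have "\<dots> = (\<Sum>k\<in>{length w}. (if w = replicate k x then 1 else 0) / fact k)"
    by (rule sum.mono_neutral_right) auto
  also have "\<dots> = (if w = replicate (length w) x then 1 else 0) / fact (length w)"
    by (simp only: sum.insert finite.emptyI empty_iff not_False_eq_True sum.empty add_0_right)
  also have "\<dots> = (if w = replicate (length w) x then 1 / fact (length w) else 0)"
    by (rule if_distrib [where f = "\<lambda>t. t / fact (length w)", THEN trans]) (simp only: div_0)
  finally show ?thesis .
qed

section \<open>The logarithm as the linear term of the powers\<close>

text \<open>The derivation that fixes \<open>Y\<close> and kills \<open>X\<close>.\<close>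

definition Yderiv :: "(letter, 'a::ring_1) ncfps \<Rightarrow> (letter, 'a) ncfps" where
  "Yderiv A = Abs_ncfps (\<lambda>w. of_nat (count_list w LY) * nc_coeff A w)"

lemma nc_coeff_Yderiv [simp]: "nc_coeff (Yderiv A) w = of_nat (count_list w LY) * nc_coeff A w"
  by (simp add: Yderiv_def)

lemma Yderiv_mult:
  fixes A B :: "(letter, 'a::comm_ring_1) ncfps"
  shows "Yderiv (A * B) = Yderiv A * B + A * Yderiv B"
proof (rule ncfps_eqI)
  fix w :: "letter list"
  have "of_nat (count_list w LY) * (nc_coeff A u * nc_coeff B v) =
      of_nat (count_list u LY) * nc_coeff A u * nc_coeff B v
      + nc_coeff A u * (of_nat (count_list v LY) * nc_coeff B v)" if "(u, v) \<in> splits w" for u v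
    using that by (auto simp: splits_def algebra_simps)
  then show "nc_coeff (Yderiv (A * B)) w = nc_coeff (Yderiv A * B + A * Yderiv B) w"
    by (auto simp: nc_coeff_mult sum_distrib_left split_beta sum.distrib [symmetric]
        intro!: sum.cong)
qed

lemma count_list_replicate: "count_list (replicate n x) x = n"
  by (induction n) simp_all

lemma Yderiv_exp_X: "Yderiv (nc_exp varX) = 0"
proof (rule ncfps_eqI)
  fix w
  show "nc_coeff (Yderiv (nc_exp varX)) w = nc_coeff 0 w"
  proof (cases "w = replicate (length w) LX")
    case True
    then have "count_list w LY = 0"
      by (metis count_list_0_iff in_set_replicate letter.distinct(1))
    then show ?thesis by simp
  next
    case False
    then show ?thesis by (simp add: varX_def nc_coeff_exp_var)
  qed
qed

text \<open>At the word of \<open>n >= 1\<close> letters \<open>LY\<close> the two sides are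
  \<open>n / fact n\<close> and \<open>1 / fact (n - 1)\<close>; at all other words both
  vanish.\<close>

lemma Yderiv_exp_Y: "Yderiv (nc_exp varY) = nc_exp varY * varY"
proof (rule ncfps_eqI)
  fix w :: "letter list"
  show "nc_coeff (Yderiv (nc_exp varY :: (letter, 'a) ncfps)) w = nc_coeff (nc_exp varY * varY) w"
  proof (cases w rule: rev_exhaust)
    case Nil
    then show ?thesis by (simp add: varY_def nc_coeff_mult_var_Nil)
  next
    case (snoc v y)
    have "v @ [y] = replicate (Suc (length v)) LY \<longleftrightarrow> v = replicate (length v) LY \<and> y = LY"
      by (simp only: replicate_Suc replicate_append_same [symmetric] append1_eq_conv)
    moreover have "count_list v LY = length v" if "v = replicate (length v) LY"
      by (metis count_list_replicate that)
    ultimately show ?thesis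
      by (auto simp: snoc varY_def nc_coeff_mult_var_snoc nc_coeff_exp_var divide_simps
          simp del: of_nat_Suc replicate_Suc)
        (simp add: algebra_simps)
  qed
qed

definition exp_XY :: "(letter, 'a::field_char_0) ncfps" where
  "exp_XY = nc_exp varX * nc_exp varY"

lemma Yderiv_exp_XY: "Yderiv exp_XY = exp_XY * varY"
  by (simp add: exp_XY_def Yderiv_mult Yderiv_exp_X Yderiv_exp_Y mult.assoc)

text \<open>Peels off the two exponentials one after the other with
  \<open>act_exp_mult\<close>.\<close>

lemma act_exp_XY_mult: "act (exp_XY * A) B * exp_XY = exp_XY * act A B"
proof -
  have "act (exp_XY * A) B * exp_XY
      = act (nc_exp varX * (nc_exp varY * A)) B * nc_exp varX * nc_exp varY"
    by (simp add: exp_XY_def mult.assoc)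
  also have "\<dots> = nc_exp varX * (act (nc_exp varY * A) B * nc_exp varY)"
    by (simp only: varX_def act_exp_mult mult.assoc)
  also have "\<dots> = exp_XY * act A B"
    by (simp only: exp_XY_def varY_def act_exp_mult mult.assoc)
  finally show ?thesis .
qed

text \<open>Letting each letter of a word act by its bracket turns \<open>e\<^sup>X e\<^sup>Y\<close> into
  \<open>e\<^bsup>ad X\<^esup> e\<^bsup>ad Y\<^esup>\<close>, which is conjugation by \<open>e\<^sup>X e\<^sup>Y\<close>.\<close>

lemma act_exp_XY_power: "act (exp_XY ^ l) B * exp_XY ^ l = exp_XY ^ l * B"
proof (induction l)
  case (Suc l)
  have "act (exp_XY ^ Suc l) B * exp_XY ^ Suc l = (act (exp_XY * exp_XY ^ l) B * exp_XY) * exp_XY ^ l"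
    by (simp add: mult.assoc)
  also have "\<dots> = exp_XY * (act (exp_XY ^ l) B * exp_XY ^ l)"
    by (simp only: act_exp_XY_mult mult.assoc)
  finally show ?case by (simp add: Suc mult.assoc)
qed (simp add: act_1)

text \<open>Induction with the product rule. The new term \<open>?G ^ Suc n * varY\<close> equals
  \<open>act (?G ^ Suc n) varY * ?G ^ Suc n\<close>, so the power of \<open>exp_XY\<close> always
  factors out on the right.\<close>

lemma Yderiv_exp_XY_power:
  "Yderiv (exp_XY ^ n :: (letter, 'a::field_char_0) ncfps) = (\<Sum>l = 1..n. act (exp_XY ^ l) varY) * exp_XY ^ n"
proof (induction n)
  case 0
  show ?case by (rule ncfps_eqI) (simp add: nc_coeff_1)
next
  case (Suc n)
  let ?G = "exp_XY :: (letter, 'a) ncfps"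
  have "Yderiv (?G ^ Suc n) = Yderiv (?G ^ n) * ?G + ?G ^ n * (?G * varY)"
    by (simp add: power_Suc2 Yderiv_mult Yderiv_exp_XY del: power_Suc)
  also have "?G ^ n * (?G * varY) = act (?G ^ Suc n) varY * ?G ^ Suc n"
    by (simp only: act_exp_XY_power) (simp only: power_Suc2 mult.assoc)
  also have "Yderiv (?G ^ n) * ?G = (\<Sum>l = 1..n. act (?G ^ l) varY) * ?G ^ Suc n"
    unfolding Suc by (simp only: power_Suc2 mult.assoc)
  finally show ?case
    by (simp add: distrib_right)
qed

section \<open>Coefficients of powers as polynomials in the exponent\<close>

text \<open>A nonzero difference has only finitely many roots. This turns identities valid for every
  exponent \<open>n\<close> into comparisons of linear coefficients.\<close>

lemma poly_eqI_of_nat: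
  fixes p q :: "'a::field_char_0 poly"
  assumes "\<And>n. poly p (of_nat n) = poly q (of_nat n)"
  shows "p = q"
proof (rule ccontr)
  assume "p \<noteq> q"
  then have "finite {x. poly (p - q) x = 0}"
    by (intro poly_roots_finite) simp
  moreover have "range of_nat \<subseteq> {x. poly (p - q) x = 0}"
    using assms by auto
  ultimately have "finite (range (of_nat :: nat \<Rightarrow> 'a))"
    by (rule rev_finite_subset)
  then show False
    using finite_imageD inj_of_nat infinite_UNIV_nat by blast
qed

text \<open>The generalized binomial coefficient \<open>(x + s) gchoose k\<close> as a polynomial in
  \<open>x\<close>; the shift \<open>s\<close> will carry the number of ascents.\<close>

definition binom_poly :: "nat \<Rightarrow> nat \<Rightarrow> 'a::field_char_0 poly" where
  "binom_poly s k = smult (1 / fact k) (\<Prod>i = 0..<k. [:of_nat s - of_nat i, 1:])"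

lemma poly_binom_poly [simp]: "poly (binom_poly s k) (of_nat n) = of_nat ((n + s) choose k)"
proof -
  have "poly (binom_poly s k) (of_nat n) = (of_nat (n + s) gchoose k :: 'a)"
    by (simp add: binom_poly_def poly_prod gbinomial_prod_rev algebra_simps)
  then show ?thesis by (simp add: binomial_gbinomial)
qed

lemma coeff_binom_poly_0: "coeff (binom_poly s k :: 'a::field_char_0 poly) 0 = of_nat (s choose k)"
proof -
  have "coeff (binom_poly s k :: 'a poly) 0 = poly (binom_poly s k) (of_nat 0)"
    by (simp only: poly_0_coeff_0 of_nat_0)
  then show ?thesis by (simp only: poly_binom_poly add_0)
qed

text \<open>For \<open>s < k\<close> the factor with \<open>i = s\<close> is the bare variable, so
  the linear coefficient is the product of the other factors at \<open>0\<close>: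
  \<open>fact s\<close> from \<open>i < s\<close> and a signed \<open>fact (k - 1 - s)\<close> from
  \<open>i > s\<close>. The signs and inverse binomial coefficients of the final formula originate
  here.\<close>

lemma coeff_binom_poly_1:
  assumes "s < k"
  shows "coeff (binom_poly s k :: 'a::field_char_0 poly) 1
    = (-1) ^ (k - 1 - s) * fact s * fact (k - 1 - s) / fact k"
proof -
  let ?f = "\<lambda>i. [:of_nat s - of_nat i, 1 :: 'a:]"
  have split: "{0..<k} = {0..<s} \<union> {Suc s..<k} \<union> {s}"
    using assms by auto
  have "(\<Prod>i = 0..<k. ?f i) = ((\<Prod>i = 0..<s. ?f i) * (\<Prod>i = Suc s..<k. ?f i)) * ?f s"
    by (subst split, subst prod.union_disjoint, simp_all, subst prod.union_disjoint) auto
  also have "\<dots> = pCons 0 ((\<Prod>i = 0..<s. ?f i) * (\<Prod>i = Suc s..<k. ?f i))"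
    by simp
  finally have "coeff (\<Prod>i = 0..<k. ?f i) 1
      = poly ((\<Prod>i = 0..<s. ?f i) * (\<Prod>i = Suc s..<k. ?f i)) 0"
    by (simp add: poly_0_coeff_0)
  also have "\<dots> = (\<Prod>i = 0..<s. of_nat s - of_nat i) * (\<Prod>i = Suc s..<k. of_nat s - of_nat i)"
    by (simp add: poly_prod)
  also have "(\<Prod>i = 0..<s. of_nat s - of_nat i) = (fact s :: 'a)"
    by (simp add: fact_prod_rev of_nat_diff)
  also have "(\<Prod>i = Suc s..<k. of_nat s - of_nat i) = (\<Prod>i\<in>{1..k - 1 - s}. - of_nat i :: 'a)"
    by (rule prod.reindex_bij_witness [where i = "\<lambda>i. i + s" and j = "\<lambda>i. i - s"])
      (use assms in \<open>auto simp: of_nat_diff\<close>)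
  also have "\<dots> = (-1) ^ (k - 1 - s) * fact (k - 1 - s)"
    by (simp add: prod_uminus fact_prod)
  finally show ?thesis
    by (simp add: binom_poly_def)
qed

text \<open>The ring is noncommutative, but \<open>1\<close> and all \<open>of_nat\<close> multiples
  commute with \<open>Z\<close>, so Pascal's rule still gives the expansion.\<close>

lemma one_plus_power:
  fixes Z :: "'a::ring_1"
  shows "(1 + Z) ^ n = (\<Sum>k\<le>n. of_nat (n choose k) * Z ^ k)"
proof (induction n)
  case (Suc n)
  have of_nat_Z: "Z * (of_nat c * A) = of_nat c * (Z * A)" for c A
    by (metis mult.assoc mult_of_nat_commute)
  have "(1 + Z) ^ Suc n = (\<Sum>k\<le>n. of_nat (n choose k) * Z ^ k) + (\<Sum>k\<le>n. of_nat (n choose k) * Z ^ Suc k)"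
    by (simp only: power_Suc Suc distrib_right mult_1_left sum_distrib_left of_nat_Z sum.distrib)
  also have "(\<Sum>k\<le>n. of_nat (n choose k) * Z ^ k) = (\<Sum>k\<le>Suc n. of_nat (n choose k) * Z ^ k)"
    by (simp add: binomial_eq_0)
  also have "(\<Sum>k\<le>n. of_nat (n choose k) * Z ^ Suc k)
      = (\<Sum>k\<le>Suc n. if k = 0 then 0 else of_nat (n choose (k - 1)) * Z ^ k)"
    by (subst sum.atMost_Suc_shift) simp
  also have "(\<Sum>k\<le>Suc n. of_nat (n choose k) * Z ^ k)
      + (\<Sum>k\<le>Suc n. if k = 0 then 0 else of_nat (n choose (k - 1)) * Z ^ k)
      = (\<Sum>k\<le>Suc n. of_nat (Suc n choose k) * Z ^ k)"
    unfolding sum.distrib [symmetric]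
  proof (rule sum.cong)
    fix k
    show "of_nat (n choose k) * Z ^ k + (if k = 0 then 0 else of_nat (n choose (k - 1)) * Z ^ k)
        = of_nat (Suc n choose k) * Z ^ k"
      by (cases k) (simp_all add: distrib_right del: power_Suc)
  qed simp
  finally show ?case .
qed simp

lemma of_nat_mult_eq_nc_scale: "of_nat c * A = nc_scale (of_nat c) A"
  by (induction c) (auto intro!: ncfps_eqI simp: algebra_simps)

lemma nc_coeff_one_plus_power:
  fixes Z :: "('v, 'a::ring_1) ncfps"
  assumes "nc_coeff Z [] = 0"
  shows "nc_coeff ((1 + Z) ^ n) w = (\<Sum>k\<le>length w. of_nat (n choose k) * nc_coeff (Z ^ k) w)"
proof -
  let ?f = "\<lambda>k. of_nat (n choose k) * nc_coeff (Z ^ k) w"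
  have "nc_coeff ((1 + Z) ^ n) w = sum ?f {..n}"
    by (simp add: one_plus_power of_nat_mult_eq_nc_scale)
  also have "\<dots> = sum ?f {..max n (length w)}"
    by (rule sum.mono_neutral_left) (auto simp: binomial_eq_0)
  also have "\<dots> = sum ?f {..length w}"
    by (rule sum.mono_neutral_right) (auto simp: nc_coeff_power_eq_0 [OF assms])
  finally show ?thesis .
qed

definition power_poly :: "('v, 'a::field_char_0) ncfps \<Rightarrow> 'v list \<Rightarrow> 'a poly" where
  "power_poly Z w = (\<Sum>k\<le>length w. smult (nc_coeff (Z ^ k) w) (binom_poly 0 k))"

text \<open>Summing \<open>l choose k\<close> over \<open>l = 1..n\<close> gives
  \<open>n choose Suc k\<close> plus, for \<open>k > 0\<close>, \<open>n choose k\<close>; at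
  \<open>k = 0\<close> the second summand is cancelled by the omitted term
  \<open>l = 0\<close>.\<close>

definition power_sum_poly :: "('v, 'a::field_char_0) ncfps \<Rightarrow> 'v list \<Rightarrow> 'a poly" where
  "power_sum_poly Z w = (\<Sum>k\<le>length w. smult (nc_coeff (Z ^ k) w)
     (binom_poly 0 (Suc k) + (if k = 0 then 0 else binom_poly 0 k)))"

lemma poly_power_poly:
  assumes "nc_coeff Z [] = 0"
  shows "poly (power_poly Z w) (of_nat n) = nc_coeff ((1 + Z) ^ n) w"
  by (simp add: power_poly_def poly_sum nc_coeff_one_plus_power [OF assms] mult.commute)

lemma coeff_power_poly_0: "coeff (power_poly Z w) 0 = (if w = [] then 1 else 0)"
proof -
  have "coeff (power_poly Z w) 0 = (\<Sum>k\<le>length w. nc_coeff (Z ^ k) w * of_nat (0 choose k))"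
    by (simp add: power_poly_def coeff_sum coeff_binom_poly_0)
  also have "\<dots> = (\<Sum>k\<in>{0}. nc_coeff (Z ^ k) w * of_nat (0 choose k))"
    by (rule sum.mono_neutral_right) (auto simp: binomial_eq_0)
  finally show ?thesis by (simp add: nc_coeff_1)
qed

text \<open>The linear coefficient of \<open>x gchoose k\<close> is
  \<open>(-1) ^ (k - 1) / k\<close> for \<open>k >= 1\<close>, which is the coefficient of
  \<open>Z ^ k\<close> in the logarithm; for \<open>k = 0\<close> the polynomial is
  constant.\<close>

lemma coeff_power_poly_1:
  fixes Z :: "('v, 'a::field_char_0) ncfps"
  assumes "nc_coeff Z [] = 0"
  shows "coeff (power_poly Z w) 1 = nc_coeff (nc_log (1 + Z)) w"
proof -
  have "coeff (power_poly Z w) 1 = (\<Sum>k\<le>length w. nc_coeff (Z ^ k) w * coeff (binom_poly 0 k) 1)"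
    by (simp add: power_poly_def coeff_sum)
  also have "\<dots> = (\<Sum>k = 1..length w. nc_coeff (Z ^ k) w * coeff (binom_poly 0 k) 1)"
    by (rule sum.mono_neutral_right) (auto simp: binom_poly_def not_less_eq_eq)
  also have "\<dots> = (\<Sum>k = 1..length w. (-1) ^ (k - 1) / of_nat k * nc_coeff (Z ^ k) w)"
  proof (rule sum.cong)
    fix k assume "k \<in> {1..length w}"
    then have "coeff (binom_poly 0 k :: 'a poly) 1 = (-1) ^ (k - 1) / of_nat k"
      by (subst coeff_binom_poly_1) (auto simp: fact_reduce [of k])
    then show "nc_coeff (Z ^ k) w * coeff (binom_poly 0 k) 1 = (-1) ^ (k - 1) / of_nat k * nc_coeff (Z ^ k) w"
      by simp
  qed simp
  also have "\<dots> = nc_coeff (nc_log (1 + Z)) w"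
    by (rule nc_coeff_log [OF assms, symmetric])
  finally show ?thesis .
qed

lemma sum_binomial_from_1:
  "(\<Sum>l = 1..n. l choose k) = (n choose Suc k) + (if k = 0 then 0 else n choose k)"
  by (induction n) (auto simp: binomial_eq_0)

lemma poly_power_sum_poly:
  fixes Z :: "('v, 'a::field_char_0) ncfps"
  assumes "nc_coeff Z [] = 0"
  shows "poly (power_sum_poly Z w) (of_nat n) = (\<Sum>l = 1..n. nc_coeff ((1 + Z) ^ l) w)"
proof -
  have "(\<Sum>l = 1..n. nc_coeff ((1 + Z) ^ l) w)
      = (\<Sum>k\<le>length w. of_nat (\<Sum>l = 1..n. l choose k) * nc_coeff (Z ^ k) w)"
    unfolding nc_coeff_one_plus_power [OF assms] of_nat_sum sum_distrib_right
    by (rule sum.swap)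
  also have "\<dots> = poly (power_sum_poly Z w) (of_nat n)"
    unfolding sum_binomial_from_1
    by (auto simp: power_sum_poly_def poly_sum algebra_simps intro!: sum.cong)
  finally show ?thesis ..
qed

lemma coeff_power_sum_poly_0: "coeff (power_sum_poly Z w) 0 = 0"
  by (auto simp: power_sum_poly_def coeff_sum coeff_binom_poly_0 binomial_eq_0 intro!: sum.neutral)

lemma nc_coeff_exp_XY_minus_1: "nc_coeff (exp_XY - 1 :: (letter, 'a::field_char_0) ncfps) [] = 0"
  unfolding exp_XY_def by (rule nc_coeff_exp_mult_Nil)

text \<open>This is the linear term in \<open>n\<close> of the identity \<open>Yderiv_exp_XY_power\<close>.\<close>

lemma count_Y_mult_nc_coeff_log:
  fixes z :: "letter list"
  defines "Z \<equiv> exp_XY - 1 :: (letter, 'a::field_char_0) ncfps"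
  shows "of_nat (count_list z LY) * nc_coeff (nc_log (exp_XY :: (letter, 'a) ncfps)) z =
    (\<Sum>w | length w \<le> length z. coeff (power_sum_poly Z w) 1 * nc_coeff (ad_word w varY) z)"
proof -
  have Z0: "nc_coeff Z [] = 0"
    unfolding Z_def by (rule nc_coeff_exp_XY_minus_1)
  have Z1: "1 + Z = exp_XY"
    by (simp add: Z_def)
  define q where "q u = (\<Sum>w | length w \<le> length u.
    smult (nc_coeff (ad_word w varY) u) (power_sum_poly Z w))" for u
  have q: "poly (q u) (of_nat n) = nc_coeff (\<Sum>l = 1..n. act (exp_XY ^ l) varY) u" for u n
  proof -
    have "poly (q u) (of_nat n) = (\<Sum>w | length w \<le> length u. \<Sum>l = 1..n.
        nc_coeff (exp_XY ^ l) w * nc_coeff (ad_word w varY) u)"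
      by (simp add: q_def poly_sum poly_power_sum_poly [OF Z0] Z1 sum_distrib_right mult.commute)
        (simp add: mult.commute sum_distrib_left)
    also have "\<dots> = nc_coeff (\<Sum>l = 1..n. act (exp_XY ^ l) varY) u"
      by (subst sum.swap) (simp add: act_def)
    finally show ?thesis .
  qed
  have "smult (of_nat (count_list z LY)) (power_poly Z z)
      = (\<Sum>(u, v)\<in>splits z. q u * power_poly Z v)"
  proof (rule poly_eqI_of_nat)
    fix n
    have "poly (smult (of_nat (count_list z LY)) (power_poly Z z)) (of_nat n)
        = nc_coeff (Yderiv (exp_XY ^ n)) z"
      by (simp add: poly_power_poly [OF Z0] Z1)
    also have "\<dots> = (\<Sum>(u, v)\<in>splits z. nc_coeff (\<Sum>l = 1..n. act (exp_XY ^ l) varY) u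
        * nc_coeff (exp_XY ^ n) v)"
      unfolding Yderiv_exp_XY_power by (rule nc_coeff_mult)
    also have "\<dots> = poly (\<Sum>(u, v)\<in>splits z. q u * power_poly Z v) (of_nat n)"
      by (simp only: q poly_sum poly_mult poly_power_poly [OF Z0] Z1 split_def)
    finally show "poly (smult (of_nat (count_list z LY)) (power_poly Z z)) (of_nat n)
        = poly (\<Sum>(u, v)\<in>splits z. q u * power_poly Z v) (of_nat n)" .
  qed
  then have "coeff (smult (of_nat (count_list z LY)) (power_poly Z z)) 1
      = coeff (\<Sum>(u, v)\<in>splits z. q u * power_poly Z v) 1"
    by simp
  then have "of_nat (count_list z LY) * nc_coeff (nc_log exp_XY) z
      = (\<Sum>(u, v)\<in>splits z. coeff (q u * power_poly Z v) 1)"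
    by (simp add: coeff_power_poly_1 [OF Z0, unfolded One_nat_def] Z1 coeff_sum split_beta)
  \<comment> \<open>As \<open>q u\<close> has no constant term, the linear term of the product is
    that of \<open>q u\<close> times the constant term of \<open>power_poly Z v\<close>, which is
    \<open>1\<close> for empty \<open>v\<close> and \<open>0\<close> otherwise.\<close>
  also have "\<dots> = (\<Sum>(u, v)\<in>splits z. coeff (q u) 1 * (if v = [] then 1 else 0))"
  proof (intro sum.cong refl, clarify)
    fix u v
    have "coeff (q u) 0 = 0"
      by (simp add: q_def coeff_sum coeff_power_sum_poly_0)
    then show "coeff (q u * power_poly Z v) 1 = coeff (q u) 1 * (if v = [] then 1 else 0)"
      by (simp add: coeff_mult coeff_power_poly_0)
  qed
  also have "\<dots> = (\<Sum>(u, v)\<in>{(z, [] :: letter list)}. coeff (q u) 1 * (if v = [] then 1 else 0))"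
    by (rule sum.mono_neutral_right [OF finite_splits]) (auto simp: splits_def split: if_splits)
  finally show ?thesis
    by (simp add: q_def coeff_sum mult.commute)
qed

section \<open>Powers of the product of exponentials and ascents\<close>

text \<open>Ties count as ascents, in accordance with the weak order used by
  \<open>sorted\<close>.\<close>

fun ascents :: "'a::linorder list \<Rightarrow> nat" where
  "ascents (x # y # v) = (if x \<le> y then 1 else 0) + ascents (y # v)"
| "ascents v = 0"

lemma ascents_less: "v \<noteq> [] \<Longrightarrow> ascents v < length v"
  by (induction v rule: ascents.induct) auto

text \<open>Cutting a list into \<open>n\<close> possibly empty sorted runs leaves \<open>n + ascents v choose length v\<close>
  possibilities; here the first run is split off.\<close>

lemma sum_sorted_prefix:
  "(\<Sum>k\<le>length v. if sorted (take k v) then (n + ascents (drop k v)) choose length (drop k v) else 0)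
    = (Suc n + ascents v) choose length v"
proof (induction v rule: ascents.induct)
  case (1 x y v)
  let ?v = "y # v"
  let ?f = "\<lambda>k. (n + ascents (drop k ?v)) choose length (drop k ?v)"
  have "(\<Sum>k\<le>length (x # ?v). if sorted (take k (x # ?v))
      then (n + ascents (drop k (x # ?v))) choose length (drop k (x # ?v)) else 0)
    = ((n + ascents (x # ?v)) choose Suc (length ?v))
      + (\<Sum>k\<le>length ?v. if sorted (x # take k ?v) then ?f k else 0)"
    unfolding length_Cons [of x ?v] sum.atMost_Suc_shift [of _ "length ?v"]
    by (simp only: take_Suc_Cons drop_Suc_Cons take_0 drop_0 sorted_simps(1) if_True length_Cons)
  \<comment> \<open>If \<open>x <= y\<close>, prepending \<open>x\<close> keeps prefixes sorted and
    the induction hypothesis applies; otherwise only the one-element prefix, at the shifted index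
    \<open>0\<close>, is sorted. In both cases Pascal's rule adds the result to the term of the
    empty prefix.\<close>
  also have "(\<Sum>k\<le>length ?v. if sorted (x # take k ?v) then ?f k else 0)
    = (if x \<le> y then (Suc n + ascents ?v) choose length ?v else (n + ascents ?v) choose length ?v)"
  proof (cases "x \<le> y")
    case True
    have "sorted (x # take k ?v) \<longleftrightarrow> sorted (take k ?v)" for k
      using True by (cases k) auto
    then show ?thesis
      using True 1 by simp
  next
    case False
    have "(\<Sum>k\<le>length ?v. if sorted (x # take k ?v) then ?f k else 0)
      = (\<Sum>k\<in>{0}. if sorted (x # take k ?v) then ?f k else 0)"
    proof (rule sum.mono_neutral_right)
      show "\<forall>k\<in>{..length ?v} - {0}. (if sorted (x # take k ?v) then ?f k else 0) = 0"
        using False by (auto simp: gr0_conv_Suc)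
    qed auto
    then show ?thesis using False by simp
  qed
  finally show ?case
    by (simp add: add.commute)
qed (auto simp: atMost_Suc)

text \<open>Hockey-stick identity; the omitted initial terms \<open>r choose k\<close> with
  \<open>r <= a\<close> vanish because \<open>a < k\<close>.\<close>

lemma sum_binomial_shifted:
  assumes "a < k"
  shows "(\<Sum>l = 1..n. (l + a) choose k) = (n + Suc a) choose Suc k"
  using assms by (induction n) (simp_all add: binomial_eq_0)

section \<open>Arrangements of labelled numbers, counted by increasing runs\<close>

definition label :: "nat \<Rightarrow> nat \<Rightarrow> letter" where
  "label i k = (if k \<le> i then LX else LY)"

text \<open>\<open>S\<close> is an arbitrary set and not just \<open>{1..N}\<close>, because the
  induction on the number of runs removes the entries of the first run.\<close>

definition arrangements :: "nat \<Rightarrow> nat set \<Rightarrow> letter list \<Rightarrow> nat list set" where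
  "arrangements i S w = {v. distinct v \<and> set v = S \<and> map (label i) v = w}"

lemma finite_arrangements [simp]: "finite S \<Longrightarrow> finite (arrangements i S w)"
  unfolding arrangements_def
  by (rule finite_subset [OF _ finite_subset_distinct]) auto

lemma length_arrangements: "v \<in> arrangements i S w \<Longrightarrow> length v = length w"
  by (auto simp: arrangements_def)

text \<open>Labels \<open>LX\<close> belong to the smaller numbers, so an increasing run spells a
  block of \<open>LX\<close> followed by a block of \<open>LY\<close>. These are precisely the words
  occurring in \<open>exp_XY\<close>.\<close>

lemma map_label_sorted_list_of_set:
  assumes "finite U"
  shows "map (label i) (sorted_list_of_set U)
    = replicate (card {s \<in> U. s \<le> i}) LX @ replicate (card {s \<in> U. i < s}) LY"
proof -
  let ?A = "{s \<in> U. s \<le> i}" and ?B = "{s \<in> U. i < s}"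
  have fin: "finite ?A" "finite ?B"
    using assms by auto
  have "sorted_list_of_set U = sorted_list_of_set ?A @ sorted_list_of_set ?B"
    by (rule sorted_distinct_set_unique) (use assms fin in \<open>auto simp: sorted_append\<close>)
  moreover have "map (label i) (sorted_list_of_set ?A) = replicate (card ?A) LX"
    using fin by (intro replicate_eqI) (auto simp: label_def)
  moreover have "map (label i) (sorted_list_of_set ?B) = replicate (card ?B) LY"
    using fin by (intro replicate_eqI) (auto simp: label_def)
  ultimately show ?thesis by simp
qed

lemma count_list_replicate_neq: "x \<noteq> y \<Longrightarrow> count_list (replicate n x) y = 0"
  by (induction n) auto

lemma nc_coeff_exp_XY:
  "nc_coeff exp_XY (replicate p LX @ replicate q LY) = 1 / (fact p * fact q)"
proof -
  have "nc_coeff exp_XY (replicate p LX @ replicate q LY)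
    = (\<Sum>(u, v)\<in>{(replicate p LX, replicate q LY)}. nc_coeff (nc_exp varX) u * nc_coeff (nc_exp varY) v)"
    unfolding exp_XY_def nc_coeff_mult
  proof (rule sum.mono_neutral_right [OF finite_splits])
    show "{(replicate p LX, replicate q LY)} \<subseteq> splits (replicate p LX @ replicate q LY)"
      by (simp add: splits_def)
    \<comment> \<open>Counting each letter fixes the lengths of \<open>u\<close> and
      \<open>v\<close>, so only the cut between the two blocks contributes.\<close>
    have "u = replicate p LX \<and> v = replicate q LY"
      if uv: "u @ v = replicate p LX @ replicate q LY"
        and u: "u = replicate (length u) LX" and v: "v = replicate (length v) LY" for u v
    proof -
      have "count_list (u @ v) LX = p" "count_list (u @ v) LY = q"
        unfolding uv by (simp_all add: count_list_replicate count_list_replicate_neq)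
      moreover have "count_list u LX = length u" "count_list u LY = 0"
        by (subst u, simp only: count_list_replicate count_list_replicate_neq letter.distinct not_False_eq_True)+
      moreover have "count_list v LX = 0" "count_list v LY = length v"
        by (subst v, simp only: count_list_replicate count_list_replicate_neq letter.distinct not_False_eq_True)+
      ultimately have "length u = p" "length v = q"
        by simp_all
      then show ?thesis using u v by metis
    qed
    then have uniq: "u = replicate p LX \<and> v = replicate q LY"
      if "(u, v) \<in> splits (replicate p LX @ replicate q LY)"
        and "u = replicate (length u) LX" and "v = replicate (length v) LY" for u v
      using that unfolding splits_def by blast
    show "\<forall>x\<in>splits (replicate p LX @ replicate q LY) - {(replicate p LX, replicate q LY)}.
        (case x of (u, v) \<Rightarrow> nc_coeff (nc_exp varX) u * nc_coeff (nc_exp varY) v) = 0"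
    proof
      fix x
      assume x: "x \<in> splits (replicate p LX @ replicate q LY) - {(replicate p LX, replicate q LY)}"
      obtain u v where [simp]: "x = (u, v)"
        by (cases x)
      have "\<not> (u = replicate (length u) LX \<and> v = replicate (length v) LY)"
        using uniq x by auto
      then show "(case x of (u, v) \<Rightarrow> nc_coeff (nc_exp varX) u * nc_coeff (nc_exp varY) v) = 0"
        unfolding varX_def varY_def nc_coeff_exp_var by auto
    qed
  qed
  then show ?thesis
    by (simp add: varX_def varY_def nc_coeff_exp_var mult.commute)
qed

lemma nc_coeff_exp_XY_eq_0:
  assumes "\<And>p q. w \<noteq> replicate p LX @ replicate q LY"
  shows "nc_coeff exp_XY w = 0"
  unfolding exp_XY_def nc_coeff_mult
proof (intro sum.neutral ballI, clarify)
  fix u v assume "(u, v) \<in> splits w"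
  then have "u @ v = w"
    by (simp add: splits_def)
  then have "\<not> (u = replicate (length u) LX \<and> v = replicate (length v) LY)"
    using assms by metis
  then show "nc_coeff (nc_exp varX) u * nc_coeff (nc_exp varY) v = 0"
    unfolding varX_def varY_def nc_coeff_exp_var by auto
qed

text \<open>The parts of \<open>U\<close> on the two sides of the cut at \<open>i\<close> are chosen
  independently.\<close>

lemma card_subsets_two_blocks:
  fixes S :: "'a::linorder set"
  assumes "finite S"
  shows "card {U. U \<subseteq> S \<and> card {s \<in> U. s \<le> i} = p \<and> card {s \<in> U. i < s} = q}
    = (card {s \<in> S. s \<le> i} choose p) * (card {s \<in> S. i < s} choose q)"
proof -
  let ?A = "{s \<in> S. s \<le> i}" and ?B = "{s \<in> S. i < s}"
  have "bij_betw (\<lambda>(P, Q). P \<union> Q) ({P. P \<subseteq> ?A \<and> card P = p} \<times> {Q. Q \<subseteq> ?B \<and> card Q = q})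
    {U. U \<subseteq> S \<and> card {s \<in> U. s \<le> i} = p \<and> card {s \<in> U. i < s} = q}"
  proof (rule bij_betw_byWitness [where f' = "\<lambda>U. ({s \<in> U. s \<le> i}, {s \<in> U. i < s})"])
    have *: "{s \<in> P \<union> Q. s \<le> i} = P \<and> {s \<in> P \<union> Q. i < s} = Q" if "P \<subseteq> ?A" "Q \<subseteq> ?B" for P Q
      using that by auto
    show "\<forall>x\<in>{P. P \<subseteq> ?A \<and> card P = p} \<times> {Q. Q \<subseteq> ?B \<and> card Q = q}.
        ({s \<in> case x of (P, Q) \<Rightarrow> P \<union> Q. s \<le> i}, {s \<in> case x of (P, Q) \<Rightarrow> P \<union> Q. i < s}) = x"
    proof
      fix x assume "x \<in> {P. P \<subseteq> ?A \<and> card P = p} \<times> {Q. Q \<subseteq> ?B \<and> card Q = q}"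
      then obtain P Q where PQ: "x = (P, Q)" "P \<subseteq> ?A" "Q \<subseteq> ?B"
        by auto
      then show "({s \<in> case x of (P, Q) \<Rightarrow> P \<union> Q. s \<le> i}, {s \<in> case x of (P, Q) \<Rightarrow> P \<union> Q. i < s}) = x"
        using * [of P Q] by simp
    qed
    show "(\<lambda>(P, Q). P \<union> Q) ` ({P. P \<subseteq> ?A \<and> card P = p} \<times> {Q. Q \<subseteq> ?B \<and> card Q = q})
      \<subseteq> {U. U \<subseteq> S \<and> card {s \<in> U. s \<le> i} = p \<and> card {s \<in> U. i < s} = q}"
    proof
      fix U assume "U \<in> (\<lambda>(P, Q). P \<union> Q) ` ({P. P \<subseteq> ?A \<and> card P = p} \<times> {Q. Q \<subseteq> ?B \<and> card Q = q})"
      then obtain P Q where PQ: "U = P \<union> Q" "P \<subseteq> ?A" "card P = p" "Q \<subseteq> ?B" "card Q = q"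
        by auto
      have "U \<subseteq> S"
        using PQ by blast
      then show "U \<in> {U. U \<subseteq> S \<and> card {s \<in> U. s \<le> i} = p \<and> card {s \<in> U. i < s} = q}"
        using * [OF PQ(2,4)] PQ(3,5) unfolding PQ(1) by simp
    qed
  qed auto
  from bij_betw_same_card [OF this] show ?thesis
    using assms by (simp add: card_cartesian_product n_subsets)
qed

text \<open>The candidates for the set of entries of a first run spelling \<open>u\<close>; an
  increasing run is determined by its set of entries.\<close>

definition initial_sets :: "nat \<Rightarrow> nat set \<Rightarrow> letter list \<Rightarrow> nat set set" where
  "initial_sets i S u = {U. U \<subseteq> S \<and> map (label i) (sorted_list_of_set U) = u}"

lemma finite_initial_sets [simp]: "finite S \<Longrightarrow> finite (initial_sets i S u)"
  by (simp add: initial_sets_def)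

text \<open>For \<open>u\<close> made of \<open>p\<close> letters \<open>LX\<close> and then
  \<open>q\<close> letters \<open>LY\<close>, the number of sets is a product of two binomial
  coefficients. Multiplied by the factorials for \<open>v\<close>, it leaves the factorials for
  \<open>u @ v\<close> over \<open>fact p * fact q\<close>, and \<open>1 / (fact p * fact q)\<close>
  is the coefficient of \<open>u\<close> in \<open>exp_XY\<close>. For any other \<open>u\<close>
  both sides are zero.\<close>

lemma card_initial_sets:
  assumes S: "finite S"
    and "card {s \<in> S. s \<le> i} = count_list (u @ v) LX" "card {s \<in> S. i < s} = count_list (u @ v) LY"
  shows "of_nat (card (initial_sets i S u)) * (fact (count_list v LX) * fact (count_list v LY))
    = (fact (count_list (u @ v) LX) * fact (count_list (u @ v) LY) * nc_coeff exp_XY u :: 'a::field_char_0)"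
proof (cases "\<exists>p q. u = replicate p LX @ replicate q LY")
  case True
  then obtain p q where u: "u = replicate p LX @ replicate q LY"
    by blast
  have "map (label i) (sorted_list_of_set U) = u
      \<longleftrightarrow> card {s \<in> U. s \<le> i} = p \<and> card {s \<in> U. i < s} = q" if "U \<subseteq> S" for U
  proof -
    have fin: "finite U"
      using that S by (rule finite_subset)
    show ?thesis
    proof
      assume "map (label i) (sorted_list_of_set U) = u"
      then have "count_list (replicate (card {s \<in> U. s \<le> i}) LX @ replicate (card {s \<in> U. i < s}) LY) c
        = count_list (replicate p LX @ replicate q LY) c" for c
        by (simp only: map_label_sorted_list_of_set [OF fin] u)
      from this [of LX] this [of LY]
      show "card {s \<in> U. s \<le> i} = p \<and> card {s \<in> U. i < s} = q"
        by (simp add: count_list_replicate count_list_replicate_neq)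
    qed (simp add: map_label_sorted_list_of_set [OF fin] u)
  qed
  then have "initial_sets i S u
      = {U. U \<subseteq> S \<and> card {s \<in> U. s \<le> i} = p \<and> card {s \<in> U. i < s} = q}"
    by (auto simp: initial_sets_def)
  then have "card (initial_sets i S u)
      = (p + count_list v LX choose p) * (q + count_list v LY choose q)"
    using assms
    by (simp add: card_subsets_two_blocks u count_list_replicate count_list_replicate_neq)
  moreover have "(of_nat (p + r choose p) :: 'a) = fact (p + r) / (fact p * fact r)" for p r
    by (simp add: binomial_fact)
  ultimately show ?thesis
    by (simp add: u nc_coeff_exp_XY count_list_replicate count_list_replicate_neq)
next
  case False
  have "initial_sets i S u = {}"
  proof (rule equals0I)
    fix U assume U: "U \<in> initial_sets i S u"
    then have "finite U"
      using S by (auto simp: initial_sets_def dest: finite_subset)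
    from map_label_sorted_list_of_set [OF this] show False
      using U False by (auto simp: initial_sets_def)
  qed
  moreover have "nc_coeff exp_XY u = (0 :: 'a)"
    using False by (intro nc_coeff_exp_XY_eq_0) blast
  ultimately show ?thesis by simp
qed

text \<open>A list with sorted first \<open>k\<close> entries amounts to the set \<open>U\<close> of
  those entries together with an arrangement of \<open>S - U\<close>.\<close>

lemma sum_arrangements_sorted_prefix:
  assumes S: "finite S" and k: "k \<le> length w"
  shows "(\<Sum>v\<in>arrangements i S w. if sorted (take k v) then f (drop k v) else 0)
    = (\<Sum>U\<in>initial_sets i S (take k w). \<Sum>v\<in>arrangements i (S - U) (drop k w). f v)"
proof -
  have "(\<Sum>v\<in>arrangements i S w. if sorted (take k v) then f (drop k v) else 0)
    = (\<Sum>v\<in>{v \<in> arrangements i S w. sorted (take k v)}. f (drop k v))"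
    using S by (simp add: sum.inter_filter)
  also have "\<dots> = (\<Sum>(U, v)\<in>(SIGMA U:initial_sets i S (take k w). arrangements i (S - U) (drop k w)). f v)"
  proof (rule sum.reindex_bij_witness [where i = "\<lambda>(U, v). sorted_list_of_set U @ v"
        and j = "\<lambda>v. (set (take k v), drop k v)"])
    fix v
    assume v: "v \<in> {v \<in> arrangements i S w. sorted (take k v)}"
    then have sl: "sorted_list_of_set (set (take k v)) = take k v"
      by (simp add: arrangements_def sorted_list_of_set.idem_if_sorted_distinct)
    then show "(case (set (take k v), drop k v) of (U, v) \<Rightarrow> sorted_list_of_set U @ v) = v"
      by simp
    have "set (drop k v) = S - set (take k v)"
    proof -
      have "distinct (take k v @ drop k v)" "set (take k v @ drop k v) = S"
        using v by (simp_all only: append_take_drop_id) (simp_all add: arrangements_def)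
      then show ?thesis
        unfolding distinct_append set_append by blast
    qed
    then show "(set (take k v), drop k v)
        \<in> (SIGMA U:initial_sets i S (take k w). arrangements i (S - U) (drop k w))"
      using v sl set_take_subset [of k v]
      by (auto simp: arrangements_def initial_sets_def take_map drop_map)
    show "(case (set (take k v), drop k v) of (U, v) \<Rightarrow> f v) = f (drop k v)"
      by simp
  next
    fix p
    assume p: "p \<in> (SIGMA U:initial_sets i S (take k w). arrangements i (S - U) (drop k w))"
    obtain U v where [simp]: "p = (U, v)"
      by (cases p)
    have fin: "finite U" and U: "U \<subseteq> S" "map (label i) (sorted_list_of_set U) = take k w"
      using p S by (auto simp: initial_sets_def dest: finite_subset)
    have "length (sorted_list_of_set U) = k"
      using U(2) k by (metis length_map length_take min.absorb2)
    then have td: "take k (sorted_list_of_set U @ v) = sorted_list_of_set U"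
      "drop k (sorted_list_of_set U @ v) = v"
      by simp_all
    show "(set (take k (case p of (U, v) \<Rightarrow> sorted_list_of_set U @ v)),
        drop k (case p of (U, v) \<Rightarrow> sorted_list_of_set U @ v)) = p"
      using fin by (simp add: td del: take_append drop_append)
    show "(case p of (U, v) \<Rightarrow> sorted_list_of_set U @ v) \<in> {v \<in> arrangements i S w. sorted (take k v)}"
      using p fin U by (auto simp: td arrangements_def simp del: take_append drop_append)
  qed
  also have "\<dots> = (\<Sum>U\<in>initial_sets i S (take k w). \<Sum>v\<in>arrangements i (S - U) (drop k w). f v)"
    using S by (intro sum.Sigma [symmetric]) auto
  finally show ?thesis .
qed

lemma count_list_take_drop: "count_list w c = count_list (take k w) c + count_list (drop k w) c"
  by (metis append_take_drop_id count_list_append)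

text \<open>Induction on \<open>n\<close>: splitting off the first run
  (\<open>sum_sorted_prefix\<close>) mirrors splitting off the first factor of
  \<open>exp_XY ^ Suc n\<close>, and \<open>card_initial_sets\<close> accounts for the
  factorials.\<close>

lemma sum_arrangements_eq_nc_coeff_exp_XY_power:
  assumes "finite S" "card {s \<in> S. s \<le> i} = count_list w LX" "card {s \<in> S. i < s} = count_list w LY"
  shows "(\<Sum>v\<in>arrangements i S w. of_nat ((n + ascents v) choose length v))
    = fact (count_list w LX) * fact (count_list w LY) * nc_coeff (exp_XY ^ n :: (letter, 'a::field_char_0) ncfps) w"
  using assms
proof (induction n arbitrary: S w)
  case 0
  show ?case
  proof (cases "w = []")
    case True
    have "S = {s \<in> S. s \<le> i} \<union> {s \<in> S. i < s}"
      by auto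
    also have "\<dots> = {}"
      using 0 True by simp
    finally have "arrangements i S w = {[]}"
      using True by (auto simp: arrangements_def)
    then show ?thesis using True by (simp add: nc_coeff_1)
  next
    case False
    \<comment> \<open>A nonempty list has fewer ascents than entries, so it has no cutting into zero
      runs.\<close>
    have "(0 + ascents v) choose length v = 0" if "v \<in> arrangements i S w" for v
      using length_arrangements [OF that] False ascents_less [of v]
      by (cases "v = []") (auto intro!: binomial_eq_0)
    then show ?thesis using False by (simp add: nc_coeff_1 binomial_eq_0)
  qed
next
  case (Suc n)
  let ?G = "exp_XY :: (letter, 'a) ncfps"
  let ?R = "\<lambda>v. of_nat ((n + ascents v) choose length v) :: 'a"
  let ?F = "fact (count_list w LX) * fact (count_list w LY) :: 'a"
  have step: "(\<Sum>v\<in>arrangements i S w. if sorted (take k v) then ?R (drop k v) else 0)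
      = ?F * (nc_coeff ?G (take k w) * nc_coeff (?G ^ n) (drop k w))" if k: "k \<le> length w" for k
  proof -
    let ?u = "take k w" and ?v = "drop k w"
    let ?F' = "fact (count_list ?v LX) * fact (count_list ?v LY) :: 'a"
    have IH: "(\<Sum>v\<in>arrangements i (S - U) ?v. ?R v) = ?F' * nc_coeff (?G ^ n) ?v"
      if U: "U \<in> initial_sets i S ?u" for U
    proof (rule Suc.IH)
      show "finite (S - U)"
        using Suc.prems by simp
      have sub: "U \<subseteq> S" and fin: "finite U"
        using U Suc.prems(1) by (auto simp: initial_sets_def dest: finite_subset)
      have u: "?u = replicate (card {s \<in> U. s \<le> i}) LX @ replicate (card {s \<in> U. i < s}) LY"
        using U map_label_sorted_list_of_set [OF fin, of i] by (simp add: initial_sets_def)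
      have "card {s \<in> S - U. s \<le> i} = card ({s \<in> S. s \<le> i} - {s \<in> U. s \<le> i})"
        by (rule arg_cong [where f = card]) auto
      also have "\<dots> = count_list w LX - count_list ?u LX"
        unfolding u using sub fin Suc.prems
        by (subst card_Diff_subset) (auto simp: count_list_replicate count_list_replicate_neq)
      finally show "card {s \<in> S - U. s \<le> i} = count_list ?v LX"
        by (simp add: count_list_take_drop [of w LX k])
      have "card {s \<in> S - U. i < s} = card ({s \<in> S. i < s} - {s \<in> U. i < s})"
        by (rule arg_cong [where f = card]) auto
      also have "\<dots> = count_list w LY - count_list ?u LY"
        unfolding u using sub fin Suc.prems
        by (subst card_Diff_subset) (auto simp: count_list_replicate count_list_replicate_neq)
      finally show "card {s \<in> S - U. i < s} = count_list ?v LY"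
        by (simp add: count_list_take_drop [of w LY k])
    qed
    have "(\<Sum>v\<in>arrangements i S w. if sorted (take k v) then ?R (drop k v) else 0)
        = (\<Sum>U\<in>initial_sets i S ?u. ?F' * nc_coeff (?G ^ n) ?v)"
      unfolding sum_arrangements_sorted_prefix [OF Suc.prems(1) k, where f = ?R]
      by (rule sum.cong) (use IH in auto)
    also have "\<dots> = of_nat (card (initial_sets i S ?u)) * ?F' * nc_coeff (?G ^ n) ?v"
      by (simp add: mult.assoc)
    also have "of_nat (card (initial_sets i S ?u)) * ?F' = ?F * nc_coeff ?G ?u"
      using card_initial_sets [of S i ?u ?v, where 'a = 'a] Suc.prems by simp
    finally show ?thesis
      by (simp add: mult.assoc)
  qed
  have "(\<Sum>v\<in>arrangements i S w. of_nat ((Suc n + ascents v) choose length v) :: 'a)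
      = (\<Sum>v\<in>arrangements i S w. \<Sum>k\<le>length w. if sorted (take k v) then ?R (drop k v) else 0)"
  proof (rule sum.cong [OF refl])
    fix v assume "v \<in> arrangements i S w"
    then have len: "length w = length v"
      by (simp add: length_arrangements)
    show "(of_nat ((Suc n + ascents v) choose length v) :: 'a)
        = (\<Sum>k\<le>length w. if sorted (take k v) then ?R (drop k v) else 0)"
      unfolding len sum_sorted_prefix [of v n, symmetric] of_nat_sum
      by (intro sum.cong) auto
  qed
  also have "\<dots> = (\<Sum>k\<le>length w. ?F * (nc_coeff ?G (take k w) * nc_coeff (?G ^ n) (drop k w)))"
    by (subst sum.swap) (simp add: step)
  also have "\<dots> = ?F * nc_coeff (?G ^ Suc n) w"
  proof -
    have "inj_on (\<lambda>k. (take k w, drop k w)) {..length w}"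
      by (rule inj_onI) (metis Pair_inject atMost_iff length_take min.absorb2)
    then show ?thesis
      by (simp add: nc_coeff_mult splits_conv sum.reindex sum_distrib_left)
  qed
  finally show ?case .
qed

text \<open>The coefficient of the statement, in terms of the number \<open>length v - 1 - ascents v\<close> of descents.\<close>

definition weight :: "nat list \<Rightarrow> 'a::field_char_0" where
  "weight v = (let d = length v - 1 - ascents v in (-1) ^ d / of_nat (length v choose d))"

lemma length_eq_count_list: "length w = count_list w LX + count_list w LY"
proof (induction w)
  case (Cons x w)
  then show ?case by (cases x) auto
qed simp

text \<open>The run count holds for every \<open>exp_XY ^ l\<close>; summed over \<open>l\<close> by
  \<open>sum_binomial_shifted\<close>, it identifies the polynomial as a combination of
  \<open>binom_poly (Suc (ascents v)) (Suc ?N)\<close>, whose linear terms are known.\<close>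

lemma coeff_power_sum_poly_exp_XY:
  fixes w :: "letter list"
  defines "i \<equiv> count_list w LX" and "j \<equiv> count_list w LY"
  assumes w: "w \<noteq> []"
  shows "coeff (power_sum_poly (exp_XY - 1 :: (letter, 'a::field_char_0) ncfps) w) 1
    = 1 / (fact i * fact j * of_nat (Suc (length w)))
      * (\<Sum>v\<in>arrangements i {1..length w} w. weight v)"
proof -
  let ?N = "length w" and ?Z = "exp_XY - 1 :: (letter, 'a) ncfps"
  let ?A = "arrangements i {1..?N} w"
  have ij: "i + j = ?N"
    by (simp add: i_def j_def length_eq_count_list)
  have "{s \<in> {1..?N}. s \<le> i} = {1..i}" "{s \<in> {1..?N}. i < s} = {Suc i..?N}"
    using ij by auto
  then have card: "card {s \<in> {1..?N}. s \<le> i} = i" "card {s \<in> {1..?N}. i < s} = j"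
    using ij by auto
  have asc: "ascents v < ?N" and len: "length v = ?N" if "v \<in> ?A" for v
    using length_arrangements [OF that] ascents_less [of v] w by (cases "v = []"; simp)+
  have "power_sum_poly ?Z w
      = smult (1 / (fact i * fact j)) (\<Sum>v\<in>?A. binom_poly (Suc (ascents v)) (Suc ?N))"
  proof (rule poly_eqI_of_nat)
    fix n
    have eq: "nc_coeff (exp_XY ^ l :: (letter, 'a) ncfps) w
        = 1 / (fact i * fact j) * (\<Sum>v\<in>?A. of_nat ((l + ascents v) choose ?N))" for l
    proof -
      have "(\<Sum>v\<in>?A. of_nat ((l + ascents v) choose ?N) :: 'a)
          = (\<Sum>v\<in>?A. of_nat ((l + ascents v) choose length v))"
        by (rule sum.cong) (auto simp: len)
      also have "\<dots> = fact i * fact j * nc_coeff (exp_XY ^ l :: (letter, 'a) ncfps) w"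
        unfolding i_def j_def
        by (rule sum_arrangements_eq_nc_coeff_exp_XY_power) (use card in \<open>simp_all add: i_def j_def\<close>)
      finally show ?thesis by simp
    qed
    have "poly (power_sum_poly ?Z w) (of_nat n) = (\<Sum>l = 1..n. nc_coeff (exp_XY ^ l) w)"
      by (simp add: poly_power_sum_poly [OF nc_coeff_exp_XY_minus_1])
    also have "\<dots> = 1 / (fact i * fact j) * (\<Sum>v\<in>?A. of_nat (\<Sum>l = 1..n. (l + ascents v) choose ?N))"
      unfolding eq sum_distrib_left [symmetric] of_nat_sum
      by (subst sum.swap) simp
    also have "\<dots> = 1 / (fact i * fact j) * (\<Sum>v\<in>?A. of_nat ((n + Suc (ascents v)) choose Suc ?N))"
      by (intro arg_cong2 [where f = "(*)"] sum.cong refl) (simp only: sum_binomial_shifted asc)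
    also have "\<dots> = poly (smult (1 / (fact i * fact j))
        (\<Sum>v\<in>?A. binom_poly (Suc (ascents v)) (Suc ?N))) (of_nat n)"
      by (simp only: poly_smult poly_sum poly_binom_poly)
    finally show "poly (power_sum_poly ?Z w) (of_nat n) = poly (smult (1 / (fact i * fact j))
        (\<Sum>v\<in>?A. binom_poly (Suc (ascents v)) (Suc ?N))) (of_nat n)" .
  qed
  then have "coeff (power_sum_poly ?Z w) 1
      = 1 / (fact i * fact j) * (\<Sum>v\<in>?A. coeff (binom_poly (Suc (ascents v)) (Suc ?N)) 1)"
    by (simp add: coeff_sum)
  also have "(\<Sum>v\<in>?A. coeff (binom_poly (Suc (ascents v)) (Suc ?N)) 1 :: 'a)
      = (\<Sum>v\<in>?A. weight v / of_nat (Suc ?N))"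
  proof (rule sum.cong [OF refl])
    fix v assume v: "v \<in> ?A"
    \<comment> \<open>\<open>d\<close> is the number of descents of \<open>v\<close>. The shift
      \<open>Suc (ascents v)\<close> is \<open>?N - d\<close>, so the linear coefficient has
      factorials of \<open>?N - d\<close> and \<open>d\<close> over that of
      \<open>Suc ?N\<close>.\<close>
    define d where "d = ?N - 1 - ascents v"
    have d: "Suc (ascents v) = ?N - d" "d \<le> ?N" "Suc ?N - 1 - (?N - d) = d"
      using asc [OF v] by (auto simp: d_def)
    have "(coeff (binom_poly (Suc (ascents v)) (Suc ?N)) 1 :: 'a)
        = (-1) ^ d * fact (?N - d) * fact d / fact (Suc ?N)"
      using coeff_binom_poly_1 [OF Suc_mono [OF asc [OF v]]] unfolding d .
    also have "\<dots> = weight v / of_nat (Suc ?N)"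
    proof -
      have "weight v = (-1) ^ d / (of_nat (?N choose d) :: 'a)"
        by (simp only: weight_def Let_def len [OF v] d_def)
      then show ?thesis
        using d(2) by (simp add: binomial_fact mult_ac)
    qed
    finally show "(coeff (binom_poly (Suc (ascents v)) (Suc ?N)) 1 :: 'a) = weight v / of_nat (Suc ?N)" .
  qed
  finally show ?thesis
    by (simp add: sum_divide_distrib [symmetric])
qed

section \<open>Words in the single letter \<open>LX\<close>, and letter counts of brackets\<close>

text \<open>On such words \<open>exp_XY\<close> behaves like \<open>e^X\<close>, and its
  \<open>n\<close>-th power like \<open>e^(nX)\<close>.\<close>

lemma nc_coeff_exp_XY_power_X:
  "nc_coeff (exp_XY ^ n) (replicate k LX) = (of_nat n ^ k / fact k :: 'a::field_char_0)"
proof (induction n arbitrary: k)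
  case 0
  show ?case by (cases k) (simp_all add: nc_coeff_1)
next
  case (Suc n)
  let ?w = "replicate k LX"
  have inj: "inj_on (\<lambda>i. (replicate i LX, replicate (k - i) LX)) {..k}"
    by (rule inj_onI) (metis Pair_inject length_replicate)
  have splits: "splits ?w = (\<lambda>i. (replicate i LX, replicate (k - i) LX)) ` {..k}"
    unfolding splits_conv by (rule image_cong) (auto simp: take_replicate min_def)
  have "nc_coeff (exp_XY ^ Suc n :: (letter, 'a) ncfps) ?w
      = (\<Sum>i\<le>k. nc_coeff exp_XY (replicate i LX) * nc_coeff (exp_XY ^ n) (replicate (k - i) LX))"
    by (simp add: nc_coeff_mult splits sum.reindex [OF inj])
  also have "\<dots> = (\<Sum>i\<le>k. of_nat (k choose i) * 1 ^ i * of_nat n ^ (k - i) / fact k)"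
  proof (rule sum.cong [OF refl])
    fix i assume "i \<in> {..k}"
    then show "nc_coeff exp_XY (replicate i LX) * nc_coeff (exp_XY ^ n) (replicate (k - i) LX)
        = (of_nat (k choose i) * 1 ^ i * of_nat n ^ (k - i) / fact k :: 'a)"
      using nc_coeff_exp_XY [of i 0, where 'a = 'a] by (simp add: Suc binomial_fact)
  qed
  also have "\<dots> = (1 + of_nat n) ^ k / fact k"
    by (simp only: binomial_ring sum_divide_distrib)
  finally show ?case by simp
qed

text \<open>\<open>n ^ k / fact k\<close> has no linear term in \<open>n\<close> when
  \<open>k >= 2\<close>. This settles the words without \<open>LY\<close>, where
  \<open>Yderiv\<close> gives no information.\<close>

lemma nc_coeff_log_exp_XY_X:
  assumes "k \<ge> 2"
  shows "nc_coeff (nc_log (exp_XY :: (letter, 'a::field_char_0) ncfps)) (replicate k LX) = 0"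
proof -
  let ?Z = "exp_XY - 1 :: (letter, 'a) ncfps"
  have "power_poly ?Z (replicate k LX) = monom (1 / fact k) k"
    by (rule poly_eqI_of_nat)
      (simp add: poly_power_poly [OF nc_coeff_exp_XY_minus_1] nc_coeff_exp_XY_power_X poly_monom)
  then show ?thesis
    using coeff_power_poly_1 [of ?Z "replicate k LX", OF nc_coeff_exp_XY_minus_1] assms
    by simp
qed

text \<open>A bracket with a variable adds that letter at one of the two ends of each word.\<close>

lemma mset_eq_if_nc_coeff_ad_word_neq_0:
  "nc_coeff (ad_word w (nc_var y) :: ('v, 'a::ring_1) ncfps) z \<noteq> 0 \<Longrightarrow> mset z = add_mset y (mset w)"
proof (induction w arbitrary: z)
  case Nil
  then show ?case by (auto simp: nc_coeff_var split: if_splits)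
next
  case (Cons x w)
  let ?A = "ad_word w (nc_var y) :: ('v, 'a) ncfps"
  from Cons.prems have "nc_coeff (nc_var x * ?A) z \<noteq> 0 \<or> nc_coeff (?A * nc_var x) z \<noteq> 0"
    by (auto simp: nc_bracket_def)
  then show ?case
  proof
    assume "nc_coeff (nc_var x * ?A) z \<noteq> 0"
    then show ?thesis
      using Cons.IH
      by (cases z) (auto simp: nc_coeff_var_mult_Nil nc_coeff_var_mult_Cons split: if_splits)
  next
    assume "nc_coeff (?A * nc_var x) z \<noteq> 0"
    then show ?thesis
      using Cons.IH
      by (cases z rule: rev_exhaust)
        (auto simp: nc_coeff_mult_var_Nil nc_coeff_mult_var_snoc split: if_splits)
  qed
qed

section \<open>Permutations in one-line notation and their descents\<close>

text \<open>The inverse is the identity outside \<open>{1..N}\<close>, as \<open>permutes\<close>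
  demands, and shifts indices by one because list positions start at \<open>0\<close>.\<close>

lemma bij_betw_permutes_lists:
  "bij_betw (\<lambda>\<sigma>. map \<sigma> [1..<Suc N]) {\<sigma>. \<sigma> permutes {1..N}} {v. distinct v \<and> set v = {1..N}}"
proof (rule bij_betw_byWitness [where f' = "\<lambda>v l. if l \<in> {1..N} then v ! (l - 1) else l"])
  show "\<forall>\<sigma>\<in>{\<sigma>. \<sigma> permutes {1..N}}.
      (\<lambda>l. if l \<in> {1..N} then map \<sigma> [1..<Suc N] ! (l - 1) else l) = \<sigma>"
    by (auto simp: fun_eq_iff permutes_not_in simp del: upt_Suc)
  have len: "length v = N" if "distinct v" "set v = {1..N}" for v
    using distinct_card [OF that(1)] that(2) by simp
  show "\<forall>v\<in>{v. distinct v \<and> set v = {1..N}}.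
      map (\<lambda>l. if l \<in> {1..N} then v ! (l - 1) else l) [1..<Suc N] = v"
    by (auto simp: len intro!: nth_equalityI simp del: upt_Suc)
  have atLeastLessThanSuc: "{Suc 0..<Suc N} = {1..N}"
    by auto
  show "(\<lambda>\<sigma>. map \<sigma> [1..<Suc N]) ` {\<sigma>. \<sigma> permutes {1..N}} \<subseteq> {v. distinct v \<and> set v = {1..N}}"
    by (auto simp: distinct_map atLeastLessThanSuc permutes_image intro: permutes_inj_on
        simp del: upt_Suc)
  show "(\<lambda>v l. if l \<in> {1..N} then v ! (l - 1) else l) ` {v. distinct v \<and> set v = {1..N}}
      \<subseteq> {\<sigma>. \<sigma> permutes {1..N}}"
  proof clarify
    fix v :: "nat list"
    assume v: "distinct v" "set v = {1..N}"
    note N = len [OF v]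
    let ?\<sigma> = "\<lambda>l. if l \<in> {1..N} then v ! (l - 1) else l"
    have "bij_betw (\<lambda>l. l - 1) {1..N} {..<N}"
      by (rule bij_betw_byWitness [where f' = Suc]) auto
    then have "bij_betw ((!) v \<circ> (\<lambda>l. l - 1)) {1..N} {1..N}"
      by (rule bij_betw_trans) (rule bij_betw_nth; use v N in simp)
    then have "bij_betw ?\<sigma> {1..N} {1..N}"
      by (rule bij_betw_cong [THEN iffD1, rotated]) simp
    then show "?\<sigma> permutes {1..N}"
      by (rule bij_imp_permutes) auto
  qed
qed

text \<open>Each adjacent pair is either a descent or an ascent.\<close>

lemma card_descents_add_ascents:
  fixes v :: "'a::linorder list"
  shows "card {l. Suc l < length v \<and> v ! l > v ! Suc l} + ascents v = length v - 1"
proof (induction v rule: ascents.induct)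
  case (1 x y v)
  let ?D = "\<lambda>v :: 'a list. {l. Suc l < length v \<and> v ! l > v ! Suc l}"
  have "l \<in> ?D (x # y # v) \<longleftrightarrow> l \<in> (if x \<le> y then {} else {0}) \<union> Suc ` ?D (y # v)" for l
    by (cases l) auto
  then have "?D (x # y # v) = (if x \<le> y then {} else {0}) \<union> Suc ` ?D (y # v)"
    by blast
  moreover have "finite (?D (y # v))"
    by (rule finite_subset [where B = "{..<length (y # v)}"]) auto
  ultimately have "card (?D (x # y # v)) = (if x \<le> y then 0 else 1) + card (?D (y # v))"
    by (auto simp: card_image)
  then show ?case using 1 by auto
qed auto

lemma descents_eq:
  "descents N \<sigma> = N - 1 - ascents (map \<sigma> [1..<Suc N])"
proof -
  let ?v = "map \<sigma> [1..<Suc N]"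
  have "{l. 1 \<le> l \<and> l < N \<and> \<sigma> l > \<sigma> (l + 1)} = Suc ` {l. Suc l < length ?v \<and> ?v ! l > ?v ! Suc l}"
    by (auto simp: image_iff gr0_conv_Suc Suc_le_eq simp del: upt_Suc)
  then have "descents N \<sigma> = card {l. Suc l < length ?v \<and> ?v ! l > ?v ! Suc l}"
    by (simp add: descents_def card_image del: upt_Suc)
  then show ?thesis
    using card_descents_add_ascents [of ?v] by (simp del: upt_Suc)
qed

section \<open>Assembling the formula\<close>

definition orderings :: "nat \<Rightarrow> nat list set" where
  "orderings N = {v. distinct v \<and> set v = {1..N}}"

lemma finite_orderings [simp]: "finite (orderings N)"
  unfolding orderings_def by (rule finite_subset [OF _ finite_subset_distinct [of "{1..N}"]]) auto

lemma length_orderings: "v \<in> orderings N \<Longrightarrow> length v = N"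
  using distinct_card by (fastforce simp: orderings_def)

lemma count_list_map_eq_card:
  assumes "distinct v"
  shows "count_list (map f v) c = card {s \<in> set v. f s = c}"
proof -
  have "count_list (map f v) c = length (filter (\<lambda>s. f s = c) v)"
    by (induction v) auto
  also have "\<dots> = card (set (filter (\<lambda>s. f s = c) v))"
    using assms by (intro distinct_card [symmetric] distinct_filter)
  finally show ?thesis by simp
qed

lemma count_list_label_orderings:
  assumes "v \<in> orderings N" "i \<le> N"
  shows "count_list (map (label i) v) LX = i" "count_list (map (label i) v) LY = N - i"
proof -
  have v: "distinct v" "set v = {1..N}"
    using assms by (auto simp: orderings_def)
  have "{s \<in> {1..N}. label i s = LX} = {1..i}" "{s \<in> {1..N}. label i s = LY} = {Suc i..N}"
    using assms(2) by (auto simp: label_def split: if_splits)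
  then show "count_list (map (label i) v) LX = i" "count_list (map (label i) v) LY = N - i"
    by (simp_all only: count_list_map_eq_card [OF v(1)] v(2)) simp_all
qed

lemma count_list_if_nc_coeff_ad_word_label_neq_0:
  assumes "nc_coeff (ad_word (map (label i) v) varY) z \<noteq> 0" "v \<in> orderings N" "i \<le> N"
  shows "count_list z LX = i" "count_list z LY = Suc (N - i)" "length z = Suc N"
proof -
  have "mset z = add_mset LY (mset (map (label i) v))"
    using assms(1) unfolding varY_def by (rule mset_eq_if_nc_coeff_ad_word_neq_0)
  then have "mset z = mset (LY # map (label i) v)"
    by simp
  then have c: "count_list z c = count_list (LY # map (label i) v) c"
    and l: "length z = length (LY # map (label i) v)" for c
    by (metis count_mset) (metis \<open>mset z = mset (LY # map (label i) v)\<close> size_mset)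
  show "count_list z LX = i" "count_list z LY = Suc (N - i)"
    unfolding c using count_list_label_orderings [OF assms(2,3)] by simp_all
  show "length z = Suc N"
    unfolding l using length_orderings [OF assms(2)] by simp
qed

text \<open>The coefficient of \<open>z\<close> in the \<open>(i, j)\<close> summand of the claimed
  formula, with permutations written as lists.\<close>

definition bch_term :: "nat \<Rightarrow> nat \<Rightarrow> nat \<Rightarrow> letter list \<Rightarrow> 'a::field_char_0" where
  "bch_term m i j z = 1 / (fact i * fact j * of_nat m)
    * (\<Sum>v\<in>orderings (m - 1). weight v * nc_coeff (ad_word (map (label i) v) varY) z)"

text \<open>Every bracket in the summand has \<open>i\<close> letters \<open>LX\<close> and,
  including the innermost \<open>varY\<close>, \<open>j\<close> letters \<open>LY\<close>. As
  \<open>1 <= j\<close>, all of \<open>1..i\<close> occur among the \<open>m - 1\<close>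
  numbers.\<close>

lemma bch_term_eq_0:
  assumes "i + j = m" "1 \<le> j" "\<not> (count_list z LX = i \<and> count_list z LY = j)"
  shows "bch_term m i j z = (0 :: 'a::field_char_0)"
proof -
  have "nc_coeff (ad_word (map (label i) v) varY :: (letter, 'a) ncfps) z = 0" if "v \<in> orderings (m - 1)" for v
  proof (rule ccontr)
    assume "nc_coeff (ad_word (map (label i) v) varY :: (letter, 'a) ncfps) z \<noteq> 0"
    moreover have "i \<le> m - 1"
      using assms by simp
    ultimately have "count_list z LX = i" "count_list z LY = Suc (m - 1 - i)"
      using that count_list_if_nc_coeff_ad_word_label_neq_0 by blast+
    then show False
      using assms by auto
  qed
  then show ?thesis by (simp add: bch_term_def)
qed

text \<open>In the expansion of \<open>Yderiv\<close> of the logarithm only words with the letters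
  of \<open>z\<close> less one \<open>LY\<close> reach \<open>z\<close>. Inserting their
  coefficients and collecting the arrangements of all these words gives one sum over
  \<open>orderings\<close>.\<close>

lemma nc_coeff_log_exp_XY:
  fixes z :: "letter list"
  defines "i \<equiv> count_list z LX" and "j \<equiv> count_list z LY"
  assumes z: "length z \<ge> 2" and j: "j \<ge> 1"
  shows "nc_coeff (nc_log (exp_XY :: (letter, 'a::field_char_0) ncfps)) z = bch_term (length z) i j z"
proof -
  define m where "m = length z"
  let ?L = "nc_coeff (nc_log (exp_XY :: (letter, 'a) ncfps)) z"
  let ?c = "\<lambda>w. coeff (power_sum_poly (exp_XY - 1 :: (letter, 'a) ncfps) w) 1"
  let ?a = "\<lambda>w. nc_coeff (ad_word w (varY :: (letter, 'a) ncfps)) z"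
  let ?F = "1 / (fact i * fact (j - 1) * of_nat m) :: 'a"
  let ?W = "{w. length w \<le> m \<and> mset z = add_mset LY (mset w)}"
  have finW: "finite ?W"
    by (rule finite_subset [OF _ finite_words [of m]]) auto
  have m: "i + j = m"
    by (simp add: i_def j_def m_def length_eq_count_list)
  have "of_nat j * ?L = (\<Sum>w | length w \<le> m. ?c w * ?a w)"
    unfolding j_def m_def by (rule count_Y_mult_nc_coeff_log)
  also have "\<dots> = (\<Sum>w\<in>?W. ?c w * ?a w)"
  proof (rule sum.mono_neutral_right)
    show "\<forall>w\<in>{w. length w \<le> m} - ?W. ?c w * ?a w = 0"
    proof
      fix w assume "w \<in> {w. length w \<le> m} - ?W"
      then have "?a w = 0"
        using mset_eq_if_nc_coeff_ad_word_neq_0 [of w LY z]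
        unfolding varY_def by blast
      then show "?c w * ?a w = 0" by simp
    qed
  qed auto
  also have "\<dots> = (\<Sum>w\<in>?W. \<Sum>v\<in>{v \<in> orderings (m - 1). map (label i) v = w}.
      ?F * (weight v * ?a (map (label i) v)))"
  proof (rule sum.cong [OF refl])
    fix w assume "w \<in> ?W"
    then have "mset z = mset (LY # w)"
      by simp
    then have c: "count_list z c = count_list (LY # w) c" for c
      by (metis count_mset)
    have cw: "count_list w LX = i" "count_list w LY = j - 1"
      using c [of LX] c [of LY] by (simp_all add: i_def j_def)
    then have len: "length w = m - 1" "Suc (length w) = m"
      using m j by (simp_all add: length_eq_count_list)
    have "w \<noteq> []"
      using len z by (auto simp: m_def)
    then have "?c w = ?F * (\<Sum>v\<in>arrangements i {1..m - 1} w. weight v)"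
      using coeff_power_sum_poly_exp_XY [of w, where 'a = 'a] unfolding cw len(2) unfolding len(1)
      by blast
    also have "arrangements i {1..m - 1} w = {v \<in> orderings (m - 1). map (label i) v = w}"
      by (auto simp: arrangements_def orderings_def)
    finally have "?c w * ?a w = (\<Sum>v\<in>{v \<in> orderings (m - 1). map (label i) v = w}.
        ?F * (weight v * ?a w))"
      by (simp only: sum_distrib_left sum_distrib_right mult.assoc)
    also have "\<dots> = (\<Sum>v\<in>{v \<in> orderings (m - 1). map (label i) v = w}.
        ?F * (weight v * ?a (map (label i) v)))"
      by (rule sum.cong) auto
    finally show "?c w * ?a w = (\<Sum>v\<in>{v \<in> orderings (m - 1). map (label i) v = w}.
        ?F * (weight v * ?a (map (label i) v)))" .
  qed
  \<comment> \<open>The sets of orderings spelling a given word partition all orderings, since each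
    of them spells some word in \<open>?W\<close>.\<close>
  also have "\<dots> = (\<Sum>v\<in>orderings (m - 1). ?F * (weight v * ?a (map (label i) v)))"
  proof (rule sum.group [OF finite_orderings finW])
    show "map (label i) ` orderings (m - 1) \<subseteq> ?W"
    proof clarify
      fix v assume v: "v \<in> orderings (m - 1)"
      have "mset z = mset (LY # map (label i) v)"
      proof (rule multiset_eqI)
        fix c
        have "i \<le> m - 1"
          using m j by simp
        note cl = count_list_label_orderings [OF v this]
        show "count (mset z) c = count (mset (LY # map (label i) v)) c"
          unfolding count_mset
          using m j cl by (cases c) (auto simp: i_def j_def)
      qed
      then show "length (map (label i) v) \<le> m \<and> mset z = add_mset LY (mset (map (label i) v))"
        using length_orderings [OF v] by simp
    qed
  qed
  also have "\<dots> = ?F * (\<Sum>v\<in>orderings (m - 1). weight v * ?a (map (label i) v))"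
    by (simp only: sum_distrib_left)
  finally have "of_nat j * ?L = ?F * (\<Sum>v\<in>orderings (m - 1). weight v * ?a (map (label i) v))" .
  \<comment> \<open>Cancelling the factor \<open>j\<close> that \<open>Yderiv\<close> produces at
    \<open>z\<close> turns \<open>fact (j - 1)\<close> into \<open>fact j\<close>.\<close>
  moreover have "?F = of_nat j * (1 / (fact i * fact j * of_nat m))"
    using j by (simp add: fact_reduce [of j])
  ultimately have "of_nat j * ?L = of_nat j * bch_term m i j z"
    by (simp only: bch_term_def mult.assoc)
  then show ?thesis
    using j by (simp add: m_def)
qed

text \<open>Only the pair of letter counts of \<open>z\<close> can contribute to the sum. If it is
  out of range, then \<open>z\<close> has the wrong length or uses a single letter, and the left
  side vanishes too.\<close>

lemma nc_coeff_bch_component: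
  assumes "m \<ge> 2"
  shows "nc_coeff (bch_component m :: (letter, 'a::field_char_0) ncfps) z
    = (\<Sum>(i, j)\<in>{(i, j). i + j = m \<and> 1 \<le> i \<and> 1 \<le> j}. bch_term m i j z)"
proof -
  let ?I = "{(i, j). i + j = m \<and> 1 \<le> i \<and> 1 \<le> j}"
  let ?i = "count_list z LX" and ?j = "count_list z LY"
  have "?I \<subseteq> {..m} \<times> {..m}"
    by auto
  then have fin: "finite ?I"
    by (rule finite_subset) simp
  have comp: "nc_coeff (bch_component m :: (letter, 'a) ncfps) z
      = (if length z = m then nc_coeff (nc_log (exp_XY :: (letter, 'a) ncfps)) z else 0)"
    by (simp add: bch_component_def nc_homog_def exp_XY_def)
  show ?thesis
  proof (cases "(?i, ?j) \<in> ?I")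
    case True
    have "(\<Sum>(i, j)\<in>?I. bch_term m i j z) = (\<Sum>(i, j)\<in>{(?i, ?j)}. bch_term m i j z :: 'a)"
      by (rule sum.mono_neutral_right [OF fin]) (use True in \<open>auto intro!: bch_term_eq_0\<close>)
    also have "\<dots> = nc_coeff (nc_log exp_XY) z"
      using True assms nc_coeff_log_exp_XY [of z, where 'a = 'a] by (simp add: length_eq_count_list)
    finally show ?thesis
      using True by (simp add: comp length_eq_count_list)
  next
    case False
    have "(\<Sum>(i, j)\<in>?I. bch_term m i j z :: 'a) = 0"
      by (rule sum.neutral) (use False in \<open>auto intro!: bch_term_eq_0\<close>)
    moreover have "nc_coeff (nc_log (exp_XY :: (letter, 'a) ncfps)) z = 0" if len: "length z = m"
    proof (cases "?j = 0")
      case True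
      have "set z \<subseteq> {LX}"
        using True letter.exhaust by (auto simp: count_list_0_iff)
      then have "z = replicate m LX"
        using len by (intro replicate_eqI) auto
      then show ?thesis
        using nc_coeff_log_exp_XY_X [OF assms] by simp
    next
      case j: False
      then have "?i = 0"
        using False len by (auto simp: length_eq_count_list)
      \<comment> \<open>With \<open>i = 0\<close> every label is \<open>LY\<close>, and
        \<open>m >= 2\<close> makes \<open>v\<close> nonempty, so the innermost bracket is
        \<open>[Y, Y] = 0\<close>.\<close>
      have "nc_coeff (ad_word (map (label 0) v) varY) z = (0 :: 'a)" if v: "v \<in> orderings (m - 1)" for v
      proof -
        have "v \<noteq> []"
          using length_orderings [OF v] assms by auto
        then obtain v' k where v': "v = v' @ [k]"
          by (metis rev_exhaust)
        have "k \<in> set v"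
          by (simp add: v')
        then have "k > 0"
          using v by (simp add: orderings_def)
        then have "ad_word (map (label 0) v) varY = ad_word (map (label 0) v') (0 :: (letter, 'a) ncfps)"
          by (simp add: v' ad_word_def nested_bracket_def label_def varY_def nc_bracket_def)
        also have "\<dots> = 0"
          by (induction v') (simp_all add: nc_bracket_def)
        finally show ?thesis by simp
      qed
      then have "bch_term m 0 ?j z = (0 :: 'a)"
        by (simp add: bch_term_def)
      then show ?thesis
        using nc_coeff_log_exp_XY [of z, where 'a = 'a] len assms j \<open>?i = 0\<close> by simp
    qed
    ultimately show ?thesis
      by (simp add: comp)
  qed
qed

theorem mainTheorem2:
  fixes m :: nat
  assumes "m \<ge> 2"
  shows "(bch_component m :: (letter, 'a::field_char_0) ncfps) =
    (\<Sum>(i, j) \<in> {(i, j). i + j = m \<and> 1 \<le> i \<and> 1 \<le> j}.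
      nc_scale (1 / fact i * (1 / fact j) * (1 / of_nat m))
        (\<Sum>\<sigma> | \<sigma> permutes {1..m - 1}.
          nc_scale ((-1) ^ descents (m - 1) \<sigma> / of_nat ((m - 1) choose descents (m - 1) \<sigma>))
            (nested_bracket
              (map (\<lambda>l. if \<sigma> l \<le> i then varX else varY) [1..<m])
              varY)))"
proof (rule ncfps_eqI)
  fix z
  let ?B = "\<lambda>i \<sigma>. nested_bracket (map (\<lambda>l. if \<sigma> l \<le> i then varX else varY) [1..<m]) varY :: (letter, 'a) ncfps"
  let ?w = "\<lambda>\<sigma>. (-1) ^ descents (m - 1) \<sigma> / of_nat ((m - 1) choose descents (m - 1) \<sigma>) :: 'a"
  have Suc: "Suc (m - 1) = m"
    using assms by simp
  have B: "?B i \<sigma> = ad_word (map (label i) (map \<sigma> [1..<m])) varY" for i \<sigma>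
    unfolding ad_word_def map_map
    by (intro arg_cong2 [where f = nested_bracket] map_cong) (auto simp: label_def varX_def varY_def)
  have w: "?w \<sigma> = weight (map \<sigma> [1..<m])" for \<sigma>
    using descents_eq [of "m - 1" \<sigma>] unfolding Suc by (simp add: weight_def Let_def)
  \<comment> \<open>Reindexing by one-line notation, which carries descents to
    \<open>weight\<close>.\<close>
  have "(\<Sum>\<sigma> | \<sigma> permutes {1..m - 1}. ?w \<sigma> * nc_coeff (?B i \<sigma>) z)
      = (\<Sum>v\<in>orderings (m - 1). weight v * nc_coeff (ad_word (map (label i) v) varY) z)" for i
    unfolding B w orderings_def
    using sum.reindex_bij_betw [OF bij_betw_permutes_lists [of "m - 1", unfolded Suc],
        of "\<lambda>v. weight v * nc_coeff (ad_word (map (label i) v) varY) z"]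
    by simp
  then have "bch_term m i j z = nc_coeff (nc_scale (1 / fact i * (1 / fact j) * (1 / of_nat m))
        (\<Sum>\<sigma> | \<sigma> permutes {1..m - 1}. nc_scale (?w \<sigma>) (?B i \<sigma>))) z" for i j
    by (simp add: bch_term_def)
  then show "nc_coeff (bch_component m) z
      = nc_coeff (\<Sum>(i, j) \<in> {(i, j). i + j = m \<and> 1 \<le> i \<and> 1 \<le> j}.
          nc_scale (1 / fact i * (1 / fact j) * (1 / of_nat m))
            (\<Sum>\<sigma> | \<sigma> permutes {1..m - 1}. nc_scale (?w \<sigma>) (?B i \<sigma>))) z"
    unfolding nc_coeff_bch_component [OF assms] nc_coeff_sum
    by (intro sum.cong refl) (simp only: split_beta)
qed

end
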